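(* Let $M$ and $M'$ be $\mathrm{GF}(4)$-representable matroids such that $M'$ is obtained from $M$ by relaxing a circuit-hyperplane. Then $M'$ has path width $3$.
   Context: If $X$ is a circuit-hyperplane of a matroid $M$ with ground set $E$, then $\mathcal{B}(M)\cup\{X\}$ is the set of bases of a matroid $M'$ on $E$, and $M'$ is said to be obtained from $M$ by relaxing the circuit-hyperplane $X$. A matroid has path width $3$ if there is an ordering $(e_1,e_2,\ldots,e_n)$ of its ground set such that $\{e_1,\ldots,e_t\}$ is $3$-separating (i.e. $r(\{e_1,\dots,e_t\})+r(E-\{e_1,\dots,e_t\})-r(E)\le 2$) for all $t\in\{1,\ldots,n\}$. *)

theory Defs
  imports "Jordan_Normal_Form.VS_Connect"
begin

section \<open>The field with four elements\<close>

text \<open>\<open>GF4 a b\<close> stands for \<open>a + b \<omega>\<close> with \<open>a, b \<in> GF(2)\<close> (represented as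
  \<^typ>\<open>bool\<close>, where addition is inequality and multiplication is conjunction) and
  \<open>\<omega>\<^sup>2 = \<omega> + 1\<close>. Since \<open>x\<^sup>4 = x\<close>, the inverse of \<open>x\<close> is \<open>x\<^sup>2\<close>.\<close>

datatype gf4 = GF4 bool bool

instantiation gf4 :: field
begin

definition zero_gf4 :: gf4 where "0 = GF4 False False"

definition one_gf4 :: gf4 where "1 = GF4 True False"

fun plus_gf4 :: "gf4 \<Rightarrow> gf4 \<Rightarrow> gf4" where
  "GF4 a b + GF4 c d = GF4 (a \<noteq> c) (b \<noteq> d)"

definition uminus_gf4 :: "gf4 \<Rightarrow> gf4" where "- x = (x :: gf4)"

definition minus_gf4 :: "gf4 \<Rightarrow> gf4 \<Rightarrow> gf4" where "x - y = x + (y :: gf4)"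

fun times_gf4 :: "gf4 \<Rightarrow> gf4 \<Rightarrow> gf4" where
  "GF4 a b * GF4 c d = GF4 ((a \<and> c) \<noteq> (b \<and> d)) (((a \<and> d) \<noteq> (b \<and> c)) \<noteq> (b \<and> d))"

definition inverse_gf4 :: "gf4 \<Rightarrow> gf4" where "inverse x = x * (x :: gf4)"

definition divide_gf4 :: "gf4 \<Rightarrow> gf4 \<Rightarrow> gf4" where "x div y = x * inverse (y :: gf4)"

instance
proof
  fix a b c :: gf4
  show "a + b + c = a + (b + c)" by (cases a; cases b; cases c) auto
  show "a + b = b + a" by (cases a; cases b) auto
  show "0 + a = a" by (cases a) (auto simp: zero_gf4_def)
  show "- a + a = 0" by (cases a) (auto simp: zero_gf4_def uminus_gf4_def)
  show "a - b = a + - b" by (simp add: minus_gf4_def uminus_gf4_def)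
  show "a * b * c = a * (b * c)" by (cases a; cases b; cases c) auto
  show "a * b = b * a" by (cases a; cases b) auto
  show "1 * a = a" by (cases a) (auto simp: one_gf4_def)
  show "(a + b) * c = a * c + b * c" by (cases a; cases b; cases c) auto
  show "(0 :: gf4) \<noteq> 1" by (simp add: zero_gf4_def one_gf4_def)
  show "a \<noteq> 0 \<Longrightarrow> inverse a * a = 1"
    by (cases a) (auto simp: zero_gf4_def one_gf4_def inverse_gf4_def)
  show "a div b = a * inverse b" by (simp add: divide_gf4_def)
  show "inverse (0 :: gf4) = 0" by (simp add: zero_gf4_def inverse_gf4_def)
qed

end

lemma UNIV_gf4: "(UNIV :: gf4 set) =
    {GF4 False False, GF4 True False, GF4 False True, GF4 True True}"
proof (intro Set.set_eqI iffI)
  fix x :: gf4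
  show "x \<in> {GF4 False False, GF4 True False, GF4 False True, GF4 True True}"
    by (cases x) auto
qed simp

instance gf4 :: finite
  by standard (simp add: UNIV_gf4)

lemma card_gf4: "card (UNIV :: gf4 set) = 4"
  by (simp add: UNIV_gf4)


section \<open>Matroids\<close>

record 'a matroid_data =
  ground :: "'a set"
  bases :: "'a set set"

locale matroid =
  fixes M :: "'a matroid_data"
  assumes finite_ground: "finite (ground M)"
    and bases_subset: "B \<in> bases M \<Longrightarrow> B \<subseteq> ground M"
    and bases_nonempty: "bases M \<noteq> {}"
    and basis_exchange:
      "\<lbrakk>B \<in> bases M; B' \<in> bases M; x \<in> B - B'\<rbrakk>
        \<Longrightarrow> \<exists>y \<in> B' - B. insert y (B - {x}) \<in> bases M"

definition indep_in :: "'a matroid_data \<Rightarrow> 'a set \<Rightarrow> bool" where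
  "indep_in M I \<longleftrightarrow> (\<exists>B \<in> bases M. I \<subseteq> B)"

definition circuit :: "'a matroid_data \<Rightarrow> 'a set \<Rightarrow> bool" where
  "circuit M C \<longleftrightarrow> C \<subseteq> ground M \<and> \<not> indep_in M C \<and> (\<forall>D. D \<subset> C \<longrightarrow> indep_in M D)"

definition rk :: "'a matroid_data \<Rightarrow> 'a set \<Rightarrow> nat" where
  "rk M X = Max (card ` {I. I \<subseteq> X \<and> indep_in M I})"

definition cl :: "'a matroid_data \<Rightarrow> 'a set \<Rightarrow> 'a set" where
  "cl M X = {e \<in> ground M. rk M (insert e X) = rk M X}"

definition hyperplane :: "'a matroid_data \<Rightarrow> 'a set \<Rightarrow> bool" where
  "hyperplane M H \<longleftrightarrow> H \<subseteq> ground M \<and> cl M H = H \<and> rk M H + 1 = rk M (ground M)"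

definition circuit_hyperplane :: "'a matroid_data \<Rightarrow> 'a set \<Rightarrow> bool" where
  "circuit_hyperplane M X \<longleftrightarrow> circuit M X \<and> hyperplane M X"

definition relax :: "'a matroid_data \<Rightarrow> 'a set \<Rightarrow> 'a matroid_data" where
  "relax M X = \<lparr>ground = ground M, bases = bases M \<union> {X}\<rparr>"

text \<open>\<open>M\<close> is the vector matroid of a family \<open>v\<close> of vectors in \<open>F\<^sup>m\<close> (the columns of a matrix with
  \<open>m\<close> rows) indexed by the ground set. A subfamily is linearly independent iff it has no
  repetitions and the set of its members is linearly independent.\<close>

definition representable_over :: "'f::field itself \<Rightarrow> 'a matroid_data \<Rightarrow> bool" where
  "representable_over F M \<longleftrightarrow>
    (\<exists>(m::nat) (v :: 'a \<Rightarrow> 'f vec).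
      (\<forall>e \<in> ground M. v e \<in> carrier_vec m) \<and>
      (\<forall>X \<subseteq> ground M. indep_in M X \<longleftrightarrow>
        inj_on v X \<and> \<not> module.lin_dep class_ring (module_vec F m) (v ` X)))"

definition three_separating :: "'a matroid_data \<Rightarrow> 'a set \<Rightarrow> bool" where
  "three_separating M X \<longleftrightarrow>
    int (rk M X) + int (rk M (ground M - X)) - int (rk M (ground M)) \<le> 2"

definition path_width_three :: "'a matroid_data \<Rightarrow> bool" where
  "path_width_three M \<longleftrightarrow>
    (\<exists>es. distinct es \<and> set es = ground M \<and>
      (\<forall>t \<in> {1..length es}. three_separating M (set (take t es))))"

end

theory Submission
  imports Defs
begin

text \<open>Write the relaxation \<open>M'\<close> as \<open>(I | A)\<close> over the basis \<open>X\<close>. In \<open>M\<close> the set \<open>X\<close> is a circuit spanning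
  a hyperplane, so after scaling its elements sum to zero and the remaining elements are
  \<open>w + \<Sum>x. B x y * x\<close> for a common vector \<open>w\<close>, where each column of \<open>B\<close> matters only up to constants.
  Since \<open>M\<close> and \<open>M'\<close> differ in \<open>X\<close> alone, the minors of \<open>A\<close> vanish together with the bordered minors
  of \<open>B\<close>. The key point is that row and column scalings of \<open>A\<close> and row and column translations of \<open>B\<close>
  make both equal to one matrix \<open>g\<close> with entries in \<open>GF(4) - {0}\<close>: it suffices to find a row relative to which all
  row differences of \<open>B\<close> are affine functions of the row ratios of \<open>A\<close>, and such a row exists because
  the obstructions form an acyclic relation on the rows. Regard \<open>g\<close> as a 3-colouring of the edges of the complete
  bipartite graph. Minors of order two and three exclude properly coloured cycles, hence every
  rectangle has a constant row or column. Removing these one at a time gives an ordering of the ground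
  set; every cut of it makes both off-diagonal blocks of \<open>A\<close> of rank at most one.\<close>

section \<open>Linear independence of families\<close>

text \<open>The obstacle is that minors of order two only compare partitions: two columns have equal
  ratios in two given rows if and only if they have equal differences there. When three classes
  occur, the induced injection of the nonzero elements into GF(4) is one of 24; 12 of these are
  affine, and the other 12 become affine after inversion, that is, after exchanging the two rows. So
  the normalisation of a pair of rows has a direction, and one base row has to suit all others.
  Along a directed chain the labels multiply in \<open>A\<close> and add in \<open>B\<close>, so a
  chain yields a compatible pair of its own. Its minors of order at most three force the labels of
  two consecutive steps to lie on a cross around one value; a minor of order four enters once, when
  neighbouring crosses share their centre. The common matrix pays off because a properly coloured
  rectangle with entries in three colours has a repeated diagonal, and then
  \<open>a * d = b * c\<close> and \<open>a + d = b + c\<close> cannot agree.\<close>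

definition lin_indep_fam :: "('e \<Rightarrow> nat \<Rightarrow> 'f::field) \<Rightarrow> 'e set \<Rightarrow> bool" where
  "lin_indep_fam v S \<longleftrightarrow> (\<forall>c. (\<forall>i. (\<Sum>e\<in>S. c e * v e i) = 0) \<longrightarrow> (\<forall>e\<in>S. c e = 0))"

lemma lin_indep_famD:
  "lin_indep_fam v S \<Longrightarrow> (\<And>i. (\<Sum>e\<in>S. c e * v e i) = 0) \<Longrightarrow> e \<in> S \<Longrightarrow> c e = 0"
  unfolding lin_indep_fam_def by blast

lemma not_lin_indep_famE:
  assumes "\<not> lin_indep_fam v S"
  obtains c e where "\<And>i. (\<Sum>e\<in>S. c e * v e i) = 0" "e \<in> S" "c e \<noteq> 0"
  using assms unfolding lin_indep_fam_def by blast

text \<open>Vectors become functions on all indices, zero from \<open>m\<close> on, so no dimension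
  has to be carried. Coefficients sit on elements rather than on vectors; a repeated vector is then
  itself a dependency, with coefficients 1 and -1, and this replaces injectivity.\<close>

lemma representable_over_functions:
  assumes "representable_over TYPE('f::field) M" and "finite (ground M)"
  obtains v :: "'a \<Rightarrow> nat \<Rightarrow> 'f::field" where
    "\<And>S. S \<subseteq> ground M \<Longrightarrow> indep_in M S \<longleftrightarrow> lin_indep_fam v S"
proof -
  from assms(1) obtain m and u :: "'a \<Rightarrow> 'f vec" where
    car: "\<forall>e \<in> ground M. u e \<in> carrier_vec m" and
    rep: "\<forall>X \<subseteq> ground M. indep_in M X \<longleftrightarrow>
        inj_on u X \<and> \<not> module.lin_dep class_ring (module_vec TYPE('f) m) (u ` X)"
    unfolding representable_over_def by blast
  interpret vec_space "TYPE('f)" m .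
  define v where "v e i = (if i < m then u e $ i else 0)" for e i
  have "indep_in M S \<longleftrightarrow> lin_indep_fam v S" if S: "S \<subseteq> ground M" for S
  proof -
    have fin: "finite S" using S assms(2) finite_subset by blast
    have carS: "u ` S \<subseteq> carrier_vec m" using car S by auto
    show ?thesis
    proof
      assume "indep_in M S"
      then have inj: "inj_on u S" and li: "\<not> lin_dep (u ` S)" using rep S by auto
      show "lin_indep_fam v S"
        unfolding lin_indep_fam_def
      proof (intro allI impI ballI)
        fix c e assume c: "\<forall>i. (\<Sum>e\<in>S. c e * v e i) = 0" and e: "e \<in> S"
        define a where "a w = c (inv_into S u w)" for w
        have a: "a (u e) = c e" if "e \<in> S" for e using inj that by (simp add: a_def)
        have "lincomb a (u ` S) = 0\<^sub>v m"
        proof (rule eq_vecI)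
          fix i assume i: "i < dim_vec (0\<^sub>v m)"
          then have im: "i < m" by simp
          have "lincomb a (u ` S) $ i = (\<Sum>x\<in>u ` S. a x * x $ i)"
            using lincomb_index[OF im carS] .
          also have "\<dots> = (\<Sum>e\<in>S. c e * u e $ i)"
            using inj a by (simp add: sum.reindex)
          also have "\<dots> = 0" using c[rule_format, of i] im by (simp add: v_def)
          finally show "lincomb a (u ` S) $ i = 0\<^sub>v m $ i" using im by simp
        next
          show "dim_vec (lincomb a (u ` S)) = dim_vec (0\<^sub>v m)"
            using lincomb_closed[OF carS] by auto
        qed
        then have "a (u e) = 0"
          using li e fin lin_dep_def by (metis (no_types, lifting) finite_imageI imageI subset_refl UNIV_I Pi_I class_ring_simps(1))
        then show "c e = 0" using a e by simp
      qed
    next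
      assume li: "lin_indep_fam v S"
      have inj: "inj_on u S"
      proof (rule inj_onI, rule ccontr)
        fix x y assume xy: "x \<in> S" "y \<in> S" "u x = u y" "x \<noteq> y"
        define c where "c = (\<lambda>e. if e = x then 1 else if e = y then - 1 else (0::'f))"
        have "(\<Sum>e\<in>S. c e * v e i) = 0" for i
        proof -
          have "(\<Sum>e\<in>S. c e * v e i) = (\<Sum>e\<in>{x,y}. c e * v e i)"
            by (rule sum.mono_neutral_right) (use fin xy in \<open>auto simp: c_def\<close>)
          also have "\<dots> = 0" using xy by (simp add: c_def v_def)
          finally show ?thesis .
        qed
        from lin_indep_famD[OF li this xy(1)] show False by (simp add: c_def)
      qed
      have "\<not> lin_dep (u ` S)"
      proof
        assume "lin_dep (u ` S)"
        then obtain a w A where A: "finite A" "A \<subseteq> u ` S" "lincomb a A = 0\<^sub>v m" "w \<in> A" "a w \<noteq> 0"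
          unfolding lin_dep_def by auto
        define c where "c e = (if u e \<in> A then a (u e) else 0)" for e
        have "(\<Sum>e\<in>S. c e * v e i) = 0" for i
        proof (cases "i < m")
          case True
          have "(\<Sum>e\<in>S. c e * v e i) = (\<Sum>e\<in>{e\<in>S. u e \<in> A}. a (u e) * u e $ i)"
            by (rule sum.mono_neutral_cong_right) (use fin True in \<open>auto simp: c_def v_def\<close>)
          also have "\<dots> = (\<Sum>x\<in>u ` {e\<in>S. u e \<in> A}. a x * x $ i)"
            by (subst sum.reindex) (use inj in \<open>auto intro: inj_on_subset\<close>)
          also have "u ` {e\<in>S. u e \<in> A} = A" using A(2) by auto
          also have "(\<Sum>x\<in>A. a x * x $ i) = lincomb a A $ i"
            using lincomb_index[OF True, of A a] A(2) carS by auto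
          also have "\<dots> = 0" using A(3) True by simp
          finally show ?thesis .
        qed (simp add: v_def)
        moreover obtain e where "e \<in> S" "u e = w" using A by auto
        ultimately have "c e = 0" using lin_indep_famD[OF li] by blast
        then show False using A \<open>u e = w\<close> by (simp add: c_def)
      qed
      then show "indep_in M S" using inj rep S by blast
    qed
  qed
  then show thesis by (rule that)
qed

text \<open>Gaussian elimination: an equation with a nonzero coefficient eliminates one unknown, so
  the unknowns stay in the majority.\<close>

lemma homogeneous_system:
  fixes a :: "'e \<Rightarrow> 't \<Rightarrow> 'f::field"
  assumes "finite T" and "finite I" and "card T < card I"
  shows "\<exists>c. (\<exists>e\<in>I. c e \<noteq> 0) \<and> (\<forall>t\<in>T. (\<Sum>e\<in>I. c e * a e t) = 0)"
  using assms
proof (induction T arbitrary: I a rule: finite_induct)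
  case empty
  then obtain e where "e \<in> I" by fastforce
  then show ?case by (intro exI[of _ "\<lambda>_. 1"]) auto
next
  case (insert s T)
  show ?case
  proof (cases "\<forall>e\<in>I. a e s = 0")
    case True
    have "card T < card I" using insert by simp
    then obtain c where "\<exists>e\<in>I. c e \<noteq> 0" "\<forall>t\<in>T. (\<Sum>e\<in>I. c e * a e t) = 0"
      using insert.IH[OF insert.prems(1)] by blast
    then show ?thesis using True by (intro exI[of _ c]) auto
  next
    case False
    then obtain d where d: "d \<in> I" "a d s \<noteq> 0" by blast
    define J where "J = I - {d}"
    have I: "I = insert d J" "d \<notin> J" "finite J" using d insert.prems by (auto simp: J_def)
    define b where "b e t = a e t - a e s / a d s * a d t" for e t
    have "card T < card J" using insert I by simp
    then obtain c where c: "\<exists>e\<in>J. c e \<noteq> 0" "\<forall>t\<in>T. (\<Sum>e\<in>J. c e * b e t) = 0"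
      using insert.IH[OF I(3)] by blast
    \<comment> \<open>The value of the pivot unknown \<open>d\<close> forced by equation
      \<open>s\<close>; substituting it turns the coefficients \<open>a\<close> into
      \<open>b\<close>.\<close>
    define z where "z = - (\<Sum>e\<in>J. c e * a e s / a d s)"
    define c' where "c' = c(d := z)"
    have split: "(\<Sum>e\<in>I. c' e * a e t) = z * a d t + (\<Sum>e\<in>J. c e * a e t)" for t
    proof -
      have "(\<Sum>e\<in>J. c' e * a e t) = (\<Sum>e\<in>J. c e * a e t)"
        by (rule sum.cong) (use I in \<open>auto simp: c'_def\<close>)
      then show ?thesis using I by (simp add: c'_def)
    qed
    have "(\<Sum>e\<in>I. c' e * a e s) = 0"
      unfolding split z_def using d by (simp add: sum_distrib_right sum_negf)
    moreover have "(\<Sum>e\<in>I. c' e * a e t) = 0" if "t \<in> T" for t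
    proof -
      have "(\<Sum>e\<in>J. c e * b e t) = (\<Sum>e\<in>J. c e * a e t) + z * a d t"
        unfolding b_def z_def
        by (simp add: sum_subtractf sum_distrib_right right_diff_distrib mult.assoc)
      then show ?thesis unfolding split using c(2) that by (simp add: add.commute)
    qed
    moreover have "\<exists>e\<in>I. c' e \<noteq> 0" using c(1) I by (auto simp: c'_def)
    ultimately show ?thesis by (intro exI[of _ c']) auto
  qed
qed

text \<open>If the bound failed, the coordinates would form a system with more unknowns than
  equations. The two families may have different index types, so that an extra spanning vector can
  be adjoined later.\<close>

lemma card_le_of_lin_indep_fam:
  assumes "lin_indep_fam v I" and "finite I" and "finite T"
    and "\<And>e. e \<in> I \<Longrightarrow> \<exists>a. \<forall>i. v e i = (\<Sum>t\<in>T. a t * u t i)"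
  shows "card I \<le> card T"
proof (rule ccontr)
  assume "\<not> card I \<le> card T"
  moreover obtain a where a: "\<And>e i. e \<in> I \<Longrightarrow> v e i = (\<Sum>t\<in>T. a e t * u t i)"
    using assms(4) by metis
  ultimately obtain c e where e: "e \<in> I" "c e \<noteq> 0" and c: "\<forall>t\<in>T. (\<Sum>e\<in>I. c e * a e t) = 0"
    using homogeneous_system[of T I a] assms by auto
  have "(\<Sum>e\<in>I. c e * v e i) = 0" for i
  proof -
    have "(\<Sum>e\<in>I. c e * v e i) = (\<Sum>e\<in>I. \<Sum>t\<in>T. c e * a e t * u t i)"
      using a by (simp add: sum_distrib_left mult.assoc)
    also have "\<dots> = (\<Sum>t\<in>T. (\<Sum>e\<in>I. c e * a e t) * u t i)"
      by (subst sum.swap) (simp add: sum_distrib_right)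
    finally show ?thesis using c by simp
  qed
  from lin_indep_famD[OF assms(1) this e(1)] show False using e by simp
qed

lemma lin_indep_fam_insert_span:
  assumes "lin_indep_fam v S" and "\<not> lin_indep_fam v (insert y S)" and "finite S" and "y \<notin> S"
  obtains a where "\<And>i. v y i = (\<Sum>x\<in>S. a x * v x i)"
proof -
  obtain c e where c: "\<And>i. (\<Sum>e\<in>insert y S. c e * v e i) = 0" "e \<in> insert y S" "c e \<noteq> 0"
    using assms(2) by (rule not_lin_indep_famE) blast
  have eq: "c y * v y i + (\<Sum>e\<in>S. c e * v e i) = 0" for i using c(1)[of i] assms by simp
  have "c y \<noteq> 0"
  proof
    assume "c y = 0"
    with eq have "(\<Sum>e\<in>S. c e * v e i) = 0" for i by simp
    from lin_indep_famD[OF assms(1) this] c \<open>c y = 0\<close> show False by blast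
  qed
  have "v y i = (\<Sum>x\<in>S. (- c x / c y) * v x i)" for i
  proof -
    have "v y i = - (\<Sum>e\<in>S. c e * v e i) / c y"
      using eq[of i] \<open>c y \<noteq> 0\<close> by (simp add: field_simps eq_neg_iff_add_eq_0 add.commute)
    then show ?thesis by (simp add: sum_divide_distrib sum_negf)
  qed
  then show thesis by (rule that)
qed

section \<open>Matrices of a relaxation\<close>

text \<open>When a basis \<open>X\<close> of the relaxation indexes the rows of \<open>A\<close> and \<open>B\<close>, the left-hand side says that
  \<open>(X - P) \<union> Q\<close> is dependent in the relaxation and the right-hand side that it is dependent in the
  original matroid; for \<open>card P = card Q\<close> they read \<open>det A[P, Q] = 0\<close> and
  \<open>det ((B[P, Q], 1), (1, 0)) = 0\<close>.\<close>

definition compatible :: "'r set \<Rightarrow> 'e set \<Rightarrow> ('r \<Rightarrow> 'e \<Rightarrow> 'f::field) \<Rightarrow> ('r \<Rightarrow> 'e \<Rightarrow> 'f) \<Rightarrow> bool" where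
  "compatible X Y A B \<longleftrightarrow> (\<forall>P\<subseteq>X. \<forall>Q\<subseteq>Y. P \<noteq> {} \<longrightarrow>
    (\<exists>c. (\<exists>q\<in>Q. c q \<noteq> 0) \<and> (\<forall>p\<in>P. (\<Sum>q\<in>Q. c q * A p q) = 0)) \<longleftrightarrow>
    (\<exists>c. (\<exists>q\<in>Q. c q \<noteq> 0) \<and> (\<Sum>q\<in>Q. c q) = 0 \<and> (\<exists>k. \<forall>p\<in>P. (\<Sum>q\<in>Q. c q * B p q) = k)))"

section \<open>Ranks and bases of a matroid\<close>

lemma (in matroid) indep_in_ground: "indep_in M S \<Longrightarrow> S \<subseteq> ground M"
  using bases_subset unfolding indep_in_def by blast

lemma (in matroid) finite_indep_cards: "finite (card ` {I. I \<subseteq> S \<and> indep_in M I})"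
proof -
  have "{I. I \<subseteq> S \<and> indep_in M I} \<subseteq> Pow (ground M)" using indep_in_ground by blast
  then show ?thesis using finite_ground by (meson finite_Pow_iff finite_imageI finite_subset)
qed

lemma (in matroid) card_le_rk: "indep_in M I \<Longrightarrow> I \<subseteq> S \<Longrightarrow> card I \<le> rk M S"
  unfolding rk_def using finite_indep_cards by (intro Max_ge) auto

lemma (in matroid) rk_le:
  assumes "\<And>I. indep_in M I \<Longrightarrow> I \<subseteq> S \<Longrightarrow> card I \<le> n"
  shows "rk M S \<le> n"
proof -
  have "indep_in M {}" using bases_nonempty unfolding indep_in_def by blast
  then show ?thesis unfolding rk_def using finite_indep_cards assms
    by (subst Max_le_iff) auto
qed

lemma (in matroid) not_indep_insert_basis:
  assumes "X \<in> bases M" "y \<notin> X"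
  shows "\<not> indep_in M (insert y X)"
proof
  assume "indep_in M (insert y X)"
  then obtain B where B: "B \<in> bases M" "insert y X \<subseteq> B" unfolding indep_in_def by blast
  then have "\<exists>z\<in>X - B. insert z (B - {y}) \<in> bases M"
    using basis_exchange[OF B(1) assms(1)] assms(2) by blast
  then show False using B by blast
qed

section \<open>Dependence in coordinates relative to \<open>X\<close>\<close>

text \<open>Coefficients on \<open>X - P\<close> are free and absorb whatever \<open>Q\<close>
  contributes to those rows, so only the rows in \<open>P\<close> constrain a relation.\<close>

lemma dependent_iff_basis_coordinates:
  fixes v :: "'a \<Rightarrow> nat \<Rightarrow> 'f::field"
  assumes "finite X" "finite Q" "P \<subseteq> X" "X \<inter> Q = {}"
    and li: "lin_indep_fam v X"
    and v: "\<And>q i. q \<in> Q \<Longrightarrow> v q i = (\<Sum>x\<in>X. A x q * v x i)"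
  shows "\<not> lin_indep_fam v ((X - P) \<union> Q) \<longleftrightarrow>
    (\<exists>c. (\<exists>q\<in>Q. c q \<noteq> 0) \<and> (\<forall>p\<in>P. (\<Sum>q\<in>Q. c q * A p q) = 0))"
proof -
  have expand: "(\<Sum>e\<in>(X - P) \<union> Q. c e * v e i) =
      (\<Sum>x\<in>X. ((if x \<in> P then 0 else c x) + (\<Sum>q\<in>Q. c q * A x q)) * v x i)" for c i
  proof -
    have "(\<Sum>e\<in>(X - P) \<union> Q. c e * v e i) = (\<Sum>e\<in>X - P. c e * v e i) + (\<Sum>q\<in>Q. c q * v q i)"
      by (rule sum.union_disjoint) (use assms in auto)
    also have "(\<Sum>e\<in>X - P. c e * v e i) = (\<Sum>x\<in>X. (if x \<in> P then 0 else c x) * v x i)"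
      by (rule sum.mono_neutral_cong_left) (use assms in auto)
    also have "(\<Sum>q\<in>Q. c q * v q i) = (\<Sum>q\<in>Q. \<Sum>x\<in>X. c q * A x q * v x i)"
      using v by (simp add: sum_distrib_left mult.assoc)
    also have "\<dots> = (\<Sum>x\<in>X. (\<Sum>q\<in>Q. c q * A x q) * v x i)"
      by (subst sum.swap) (simp add: sum_distrib_right)
    finally show ?thesis by (simp add: sum.distrib distrib_right)
  qed
  show ?thesis
  proof
    assume "\<not> lin_indep_fam v ((X - P) \<union> Q)"
    then obtain c e where c: "\<And>i. (\<Sum>e\<in>(X - P) \<union> Q. c e * v e i) = 0"
      and e: "e \<in> (X - P) \<union> Q" "c e \<noteq> 0" by (rule not_lin_indep_famE) blast
    have coef: "(if x \<in> P then 0 else c x) + (\<Sum>q\<in>Q. c q * A x q) = 0" if "x \<in> X" for x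
      using lin_indep_famD[OF li, of "\<lambda>x. (if x \<in> P then 0 else c x) + (\<Sum>q\<in>Q. c q * A x q)" x]
        c that unfolding expand by simp
    have "\<exists>q\<in>Q. c q \<noteq> 0"
    proof (rule ccontr)
      assume n: "\<not> ?thesis"
      then have "(\<Sum>q\<in>Q. c q * A x q) = 0" for x by simp
      then show False using coef[of e] e n by auto
    qed
    moreover have "(\<Sum>q\<in>Q. c q * A p q) = 0" if "p \<in> P" for p
      using coef[of p] that assms(3) by auto
    ultimately show "\<exists>c. (\<exists>q\<in>Q. c q \<noteq> 0) \<and> (\<forall>p\<in>P. (\<Sum>q\<in>Q. c q * A p q) = 0)" by blast
  next
    assume "\<exists>c. (\<exists>q\<in>Q. c q \<noteq> 0) \<and> (\<forall>p\<in>P. (\<Sum>q\<in>Q. c q * A p q) = 0)"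
    then obtain c q where q: "q \<in> Q" "c q \<noteq> 0" and c: "\<forall>p\<in>P. (\<Sum>q\<in>Q. c q * A p q) = 0" by blast
    define c' where "c' e = (if e \<in> Q then c e else - (\<Sum>q\<in>Q. c q * A e q))" for e
    have "(\<Sum>q\<in>Q. c' q * A x q) = (\<Sum>q\<in>Q. c q * A x q)" for x
      by (rule sum.cong) (auto simp: c'_def)
    then have "(if x \<in> P then 0 else c' x) + (\<Sum>q\<in>Q. c' q * A x q) = 0" if "x \<in> X" for x
      using that c assms(4) by (auto simp: c'_def)
    then have "(\<Sum>e\<in>(X - P) \<union> Q. c' e * v e i) = 0" for i unfolding expand by simp
    moreover have "c' q \<noteq> 0" using q by (simp add: c'_def)
    ultimately show "\<not> lin_indep_fam v ((X - P) \<union> Q)"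
      using lin_indep_famD[of v "(X - P) \<union> Q" c' q] q(1) by blast
  qed
qed

text \<open>Now \<open>X\<close> carries a one-dimensional space of relations, spanned by
  \<open>d\<close>, so the total coefficients on \<open>X\<close> must form a multiple of
  \<open>d\<close> instead of zero. As \<open>w0\<close> lies outside the span of \<open>X\<close>,
  its coefficient must vanish as well. These two effects are the border of the matrix.\<close>

lemma dependent_iff_circuit_coordinates:
  fixes w :: "'a \<Rightarrow> nat \<Rightarrow> 'f::field"
  assumes fin: "finite X" "finite Q" and PX: "P \<subseteq> X" "P \<noteq> {}" and disj: "X \<inter> Q = {}"
    and li: "\<And>x. x \<in> X \<Longrightarrow> lin_indep_fam w (X - {x})"
    and d: "\<And>i. (\<Sum>x\<in>X. d x * w x i) = 0" "\<And>x. x \<in> X \<Longrightarrow> d x \<noteq> 0"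
    and w0: "\<And>a. \<not> (\<forall>i. w0 i = (\<Sum>x\<in>X. a x * w x i))"
    and w: "\<And>q i. q \<in> Q \<Longrightarrow> w q i = t q * w0 i + (\<Sum>x\<in>X. b x q * w x i)"
    and t: "\<And>q. q \<in> Q \<Longrightarrow> t q \<noteq> 0"
  shows "\<not> lin_indep_fam w ((X - P) \<union> Q) \<longleftrightarrow>
    (\<exists>c. (\<exists>q\<in>Q. c q \<noteq> 0) \<and> (\<Sum>q\<in>Q. c q) = 0 \<and>
      (\<exists>k. \<forall>p\<in>P. (\<Sum>q\<in>Q. c q * (b p q / (t q * d p))) = k))"
proof -
  \<comment> \<open>Subtracting the multiple of \<open>d\<close> that kills the coefficient at
    \<open>z\<close> leaves a relation on the independent family \<open>X - {z}\<close>.\<close>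
  have proportional: "\<exists>k. \<forall>x\<in>X. a x = k * d x" if a: "\<And>i. (\<Sum>x\<in>X. a x * w x i) = 0" for a
  proof (cases "X = {}")
    case False
    then obtain z where z: "z \<in> X" by blast
    define k where "k = a z / d z"
    have kz: "a z - k * d z = 0" using d(2)[OF z] by (simp add: k_def)
    have "(\<Sum>x\<in>X. (a x - k * d x) * w x i) = 0" for i
    proof -
      have "(\<Sum>x\<in>X. (a x - k * d x) * w x i) = (\<Sum>x\<in>X. a x * w x i) - k * (\<Sum>x\<in>X. d x * w x i)"
        by (simp add: sum_subtractf sum_distrib_left left_diff_distrib mult.assoc)
      then show ?thesis using a d by simp
    qed
    then have "(\<Sum>x\<in>X - {z}. (a x - k * d x) * w x i) = 0" for i
      using kz z fin(1) by (simp add: sum.remove[of X z])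
    then have "a x - k * d x = 0" if "x \<in> X - {z}" for x
      using lin_indep_famD[OF li[OF z], of "\<lambda>x. a x - k * d x" x] that by simp
    then show ?thesis using kz by (intro exI[of _ k]) auto
  qed simp
  have expand: "(\<Sum>e\<in>(X - P) \<union> Q. c e * w e i) = (\<Sum>q\<in>Q. c q * t q) * w0 i +
      (\<Sum>x\<in>X. ((if x \<in> P then 0 else c x) + (\<Sum>q\<in>Q. c q * b x q)) * w x i)" for c i
  proof -
    have "(\<Sum>e\<in>(X - P) \<union> Q. c e * w e i) = (\<Sum>e\<in>X - P. c e * w e i) + (\<Sum>q\<in>Q. c q * w q i)"
      by (rule sum.union_disjoint) (use assms in auto)
    also have "(\<Sum>e\<in>X - P. c e * w e i) = (\<Sum>x\<in>X. (if x \<in> P then 0 else c x) * w x i)"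
      by (rule sum.mono_neutral_cong_left) (use assms in auto)
    also have "(\<Sum>q\<in>Q. c q * w q i) = (\<Sum>q\<in>Q. c q * t q * w0 i + (\<Sum>x\<in>X. c q * b x q * w x i))"
      using w by (simp add: sum_distrib_left mult.assoc distrib_left)
    also have "\<dots> = (\<Sum>q\<in>Q. c q * t q) * w0 i + (\<Sum>q\<in>Q. \<Sum>x\<in>X. c q * b x q * w x i)"
      by (simp add: sum.distrib sum_distrib_right)
    also have "(\<Sum>q\<in>Q. \<Sum>x\<in>X. c q * b x q * w x i) = (\<Sum>x\<in>X. (\<Sum>q\<in>Q. c q * b x q) * w x i)"
      by (subst sum.swap) (simp add: sum_distrib_right)
    finally show ?thesis by (simp add: sum.distrib distrib_right algebra_simps)
  qed
  show ?thesis
  proof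
    assume "\<not> lin_indep_fam w ((X - P) \<union> Q)"
    then obtain c e where c: "\<And>i. (\<Sum>e\<in>(X - P) \<union> Q. c e * w e i) = 0"
      and e: "e \<in> (X - P) \<union> Q" "c e \<noteq> 0" by (rule not_lin_indep_famE) blast
    define a where "a x = (if x \<in> P then 0 else c x) + (\<Sum>q\<in>Q. c q * b x q)" for x
    have rel: "(\<Sum>q\<in>Q. c q * t q) * w0 i + (\<Sum>x\<in>X. a x * w x i) = 0" for i
      using c[of i] unfolding expand a_def .
    have s0: "(\<Sum>q\<in>Q. c q * t q) = 0"
    proof (rule ccontr)
      let ?s = "\<Sum>q\<in>Q. c q * t q"
      assume s: "?s \<noteq> 0"
      have "w0 i = (\<Sum>x\<in>X. (- a x / ?s) * w x i)" for i
      proof -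
        have "w0 i = - (\<Sum>x\<in>X. a x * w x i) / ?s"
          using rel[of i] s by (simp add: field_simps eq_neg_iff_add_eq_0)
        then show ?thesis by (simp add: sum_divide_distrib sum_negf)
      qed
      then show False using w0[of "\<lambda>x. - a x / ?s"] by simp
    qed
    then obtain k where k: "\<forall>x\<in>X. a x = k * d x" using proportional[of a] rel by auto
    have "\<exists>q\<in>Q. c q \<noteq> 0"
    proof (rule ccontr)
      assume n: "\<not> ?thesis"
      then have a': "a x = (if x \<in> P then 0 else c x)" for x by (simp add: a_def)
      \<comment> \<open>A row in \<open>P\<close> has no coefficient of its own, which forces
        \<open>k = 0\<close>; this is why \<open>P\<close> must be nonempty.\<close>
      obtain p where p: "p \<in> P" using PX by blast
      then have "k * d p = 0" using k a' PX by (metis subsetD)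
      then have "k = 0" using d(2) p PX by auto
      then show False using k a' e n by auto
    qed
    moreover have "(\<Sum>q\<in>Q. c q * t q * (b p q / (t q * d p))) = k" if p: "p \<in> P" for p
    proof -
      have "(\<Sum>q\<in>Q. c q * t q * (b p q / (t q * d p))) = (\<Sum>q\<in>Q. c q * b p q) / d p"
        unfolding sum_divide_distrib by (rule sum.cong) (use t in auto)
      also have "\<dots> = k"
      proof -
        have "a p = k * d p" "d p \<noteq> 0" using k p PX d(2) by auto
        then show ?thesis using p by (simp add: a_def)
      qed
      finally show ?thesis .
    qed
    ultimately show "\<exists>c. (\<exists>q\<in>Q. c q \<noteq> 0) \<and> (\<Sum>q\<in>Q. c q) = 0 \<and>
        (\<exists>k. \<forall>p\<in>P. (\<Sum>q\<in>Q. c q * (b p q / (t q * d p))) = k)"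
      using s0 t by (intro exI[of _ "\<lambda>q. c q * t q"]) auto
  next
    assume "\<exists>c. (\<exists>q\<in>Q. c q \<noteq> 0) \<and> (\<Sum>q\<in>Q. c q) = 0 \<and>
        (\<exists>k. \<forall>p\<in>P. (\<Sum>q\<in>Q. c q * (b p q / (t q * d p))) = k)"
    then obtain c q k where q: "q \<in> Q" "c q \<noteq> 0" and s: "(\<Sum>q\<in>Q. c q) = 0"
      and k: "\<And>p. p \<in> P \<Longrightarrow> (\<Sum>q\<in>Q. c q * (b p q / (t q * d p))) = k" by blast
    \<comment> \<open>On \<open>Q\<close> this undoes the scaling by \<open>t\<close>; on
      \<open>X - P\<close> the coefficient is chosen to bring the total to
      \<open>k * d e\<close>.\<close>
    define c' where "c' e = (if e \<in> Q then c e / t e else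
        k * d e - (\<Sum>q\<in>Q. c q / t q * b e q))" for e
    have sum_b: "(\<Sum>q\<in>Q. c' q * b x q) = (\<Sum>q\<in>Q. c q / t q * b x q)" for x
      by (rule sum.cong) (auto simp: c'_def)
    have "(if x \<in> P then 0 else c' x) + (\<Sum>q\<in>Q. c' q * b x q) = k * d x" if x: "x \<in> X" for x
    proof (cases "x \<in> P")
      case True
      have "(\<Sum>q\<in>Q. c q / t q * b x q) = (\<Sum>q\<in>Q. c q * (b x q / (t q * d x))) * d x"
        unfolding sum_distrib_right by (rule sum.cong) (use d(2)[OF x] in auto)
      then show ?thesis using k[OF True] True sum_b by simp
    next
      case False
      then show ?thesis using x disj sum_b by (auto simp: c'_def)
    qed
    then have "(\<Sum>x\<in>X. ((if x \<in> P then 0 else c' x) + (\<Sum>q\<in>Q. c' q * b x q)) * w x i) =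
        k * (\<Sum>x\<in>X. d x * w x i)" for i
      by (simp add: sum_distrib_left mult.assoc)
    moreover have "(\<Sum>q\<in>Q. c' q * t q) = (\<Sum>q\<in>Q. c q)"
      by (rule sum.cong) (use t in \<open>auto simp: c'_def\<close>)
    ultimately have "(\<Sum>e\<in>(X - P) \<union> Q. c' e * w e i) = 0" for i
      unfolding expand using s d by simp
    moreover have "c' q \<noteq> 0" using q t by (simp add: c'_def)
    ultimately show "\<not> lin_indep_fam w ((X - P) \<union> Q)"
      using lin_indep_famD[of w "(X - P) \<union> Q" c' q] q(1) by blast
  qed
qed

lemma (in matroid) circuit_relation:
  fixes w :: "'a \<Rightarrow> nat \<Rightarrow> 'f::field"
  assumes w: "\<And>S. S \<subseteq> ground M \<Longrightarrow> indep_in M S \<longleftrightarrow> lin_indep_fam w S"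
    and circ: "circuit M X"
  obtains d where "\<And>i. (\<Sum>x\<in>X. d x * w x i) = 0" "\<And>x. x \<in> X \<Longrightarrow> d x \<noteq> 0"
proof -
  have X: "X \<subseteq> ground M" "\<not> indep_in M X" "\<And>D. D \<subset> X \<Longrightarrow> indep_in M D"
    using circ unfolding circuit_def by auto
  have fin: "finite X" using X(1) finite_ground finite_subset by blast
  obtain d e where d: "\<And>i. (\<Sum>x\<in>X. d x * w x i) = 0" and e: "e \<in> X" "d e \<noteq> 0"
    using X(1,2) w by (metis not_lin_indep_famE)
  have "d x \<noteq> 0" if x: "x \<in> X" for x
  proof
    assume dx: "d x = 0"
    have "lin_indep_fam w (X - {x})" using X x w[of "X - {x}"] by blast
    moreover have "(\<Sum>x\<in>X - {x}. d x * w x i) = 0" for i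
      using d[of i] dx x fin by (simp add: sum.remove[of X x])
    ultimately have "d e = 0" using lin_indep_famD[of w "X - {x}" d e] e dx by blast
    then show False using e by simp
  qed
  then show thesis using d that by blast
qed

text \<open>The circuit relation expresses one member \<open>z\<close> by the others. If
  \<open>y\<close> were in the span of \<open>X\<close>, then \<open>insert y X\<close> would have
  rank at most \<open>card (X - {z})\<close>, which \<open>X\<close> already reaches, and closedness
  would put \<open>y\<close> into \<open>X\<close>.\<close>

lemma (in matroid) circuit_hyperplane_not_span:
  fixes w :: "'a \<Rightarrow> nat \<Rightarrow> 'f::field"
  assumes w: "\<And>S. S \<subseteq> ground M \<Longrightarrow> indep_in M S \<longleftrightarrow> lin_indep_fam w S"
    and ch: "circuit_hyperplane M X" and y: "y \<in> ground M - X"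
  shows "\<not> (\<forall>i. w y i = (\<Sum>x\<in>X. a x * w x i))"
proof
  assume a: "\<forall>i. w y i = (\<Sum>x\<in>X. a x * w x i)"
  have circ: "circuit M X" and hyp: "cl M X = X" using ch unfolding circuit_hyperplane_def hyperplane_def by auto
  have X: "X \<subseteq> ground M" "\<not> indep_in M X" "\<And>D. D \<subset> X \<Longrightarrow> indep_in M D"
    using circ unfolding circuit_def by auto
  have fin: "finite X" using X(1) finite_ground finite_subset by blast
  obtain d where d: "\<And>i. (\<Sum>x\<in>X. d x * w x i) = 0" "\<And>x. x \<in> X \<Longrightarrow> d x \<noteq> 0"
    using circuit_relation[OF w circ] by blast
  have "indep_in M {}" using bases_nonempty unfolding indep_in_def by blast
  then obtain z where z: "z \<in> X" using X(2) by (metis ex_in_conv)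
  have wz: "w z i = (\<Sum>x\<in>X - {z}. (- d x / d z) * w x i)" for i
  proof -
    have "d z * w z i + (\<Sum>x\<in>X - {z}. d x * w x i) = 0"
      using d(1)[of i] z fin by (simp add: sum.remove[of X z])
    then have "w z i = - (\<Sum>x\<in>X - {z}. d x * w x i) / d z"
      using d(2)[OF z] by (simp add: field_simps eq_neg_iff_add_eq_0)
    then show ?thesis by (simp add: sum_divide_distrib sum_negf)
  qed
  have span: "\<exists>b. \<forall>i. w e i = (\<Sum>x\<in>X - {z}. b x * w x i)" if e: "e \<in> insert y X" for e
  proof -
    consider "e = y" | "e = z" | "e \<in> X - {z}" using e by blast
    then show ?thesis
    proof cases
      case 1
      have "w e i = (\<Sum>x\<in>X - {z}. (a z * (- d x / d z) + a x) * w x i)" for i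
      proof -
        have "w e i = a z * w z i + (\<Sum>x\<in>X - {z}. a x * w x i)"
          using a 1 z fin by (simp add: sum.remove[of X z])
        then show ?thesis unfolding wz distrib_right sum.distrib sum_distrib_left mult.assoc .
      qed
      then show ?thesis by (intro exI[of _ "\<lambda>x. a z * (- d x / d z) + a x"]) simp
    next
      case 2
      then show ?thesis using wz by (intro exI[of _ "\<lambda>x. - d x / d z"]) simp
    next
      case 3
      have "w e i = (\<Sum>x\<in>X - {z}. (if x = e then 1 else 0) * w x i)" for i
        using 3 fin by (simp add: if_distrib[of "\<lambda>u. u * _"] sum.delta cong: if_cong)
      then show ?thesis by (intro exI[of _ "\<lambda>x. if x = e then 1 else 0"]) simp
    qed
  qed
  have "rk M (insert y X) \<le> card (X - {z})"
  proof (rule rk_le)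
    fix I assume I: "indep_in M I" "I \<subseteq> insert y X"
    have "I \<subseteq> ground M" using I indep_in_ground by blast
    then show "card I \<le> card (X - {z})"
      using card_le_of_lin_indep_fam[of w I "X - {z}" w] w[of I] I span fin finite_ground
      by (meson finite_Diff finite_subset subsetD)
  qed
  also have "card (X - {z}) \<le> rk M X" using X(3) z by (intro card_le_rk) auto
  finally have "rk M (insert y X) \<le> rk M X" .
  moreover have "rk M X \<le> rk M (insert y X)"
    by (rule rk_le) (auto intro: card_le_rk)
  ultimately have "y \<in> cl M X" using y unfolding cl_def by auto
  then show False using hyp y by auto
qed

text \<open>The vector \<open>w y0\<close> of one fixed element outside \<open>X\<close> serves as
  the common vector. Any other \<open>y\<close> is linked to it through a single row
  \<open>z\<close>: two columns of one row are always dependent, so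
  \<open>(X - {z}) \<union> {y0, y}\<close> is dependent in the relaxation and hence in
  \<open>M\<close>.\<close>

lemma relaxation_compatible:
  fixes M M' :: "'a matroid_data"
  assumes M: "matroid M" and M': "matroid M'"
    and rep: "representable_over TYPE('f::field) M" "representable_over TYPE('f) M'"
    and ch: "circuit_hyperplane M X" and rel: "M' = relax M X"
  obtains A B :: "'a \<Rightarrow> 'a \<Rightarrow> 'f::field" and v :: "'a \<Rightarrow> nat \<Rightarrow> 'f" where
    "compatible X (ground M' - X) A B"
    "\<And>S. S \<subseteq> ground M' \<Longrightarrow> indep_in M' S \<longleftrightarrow> lin_indep_fam v S"
    "\<And>y i. y \<in> ground M' - X \<Longrightarrow> v y i = (\<Sum>x\<in>X. A x y * v x i)"
proof -
  interpret M: matroid M by fact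
  interpret M': matroid M' by fact
  have E: "ground M' = ground M" and bas: "bases M' = insert X (bases M)"
    using rel by (auto simp: relax_def)
  have circ: "circuit M X" using ch unfolding circuit_hyperplane_def by auto
  have X: "X \<subseteq> ground M" "\<not> indep_in M X" "\<And>D. D \<subset> X \<Longrightarrow> indep_in M D"
    using circ unfolding circuit_def by auto
  have fin: "finite X" using X(1) M.finite_ground finite_subset by blast
  have indep': "indep_in M' S \<longleftrightarrow> indep_in M S \<or> S \<subseteq> X" for S
    unfolding indep_in_def bas by blast
  define Y where "Y = ground M - X"
  have finY: "finite Y" using M.finite_ground by (simp add: Y_def)
  obtain v :: "'a \<Rightarrow> nat \<Rightarrow> 'f" where
    v: "\<And>S. S \<subseteq> ground M' \<Longrightarrow> indep_in M' S \<longleftrightarrow> lin_indep_fam v S"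
    using representable_over_functions[OF rep(2) M'.finite_ground] by blast
  obtain w :: "'a \<Rightarrow> nat \<Rightarrow> 'f" where
    w: "\<And>S. S \<subseteq> ground M \<Longrightarrow> indep_in M S \<longleftrightarrow> lin_indep_fam w S"
    using representable_over_functions[OF rep(1) M.finite_ground] by blast
  have vX: "lin_indep_fam v X" using v[of X] X(1) indep' E by auto
  have "\<exists>a. \<forall>i. v y i = (\<Sum>x\<in>X. a x * v x i)" if y: "y \<in> Y" for y
  proof -
    have "\<not> indep_in M' (insert y X)"
      using M'.not_indep_insert_basis[of X y] y bas by (auto simp: Y_def)
    then have "\<not> lin_indep_fam v (insert y X)" using v[of "insert y X"] X(1) y E by (auto simp: Y_def)
    then show ?thesis using lin_indep_fam_insert_span[OF vX _ fin] y
      by (metis DiffD2 Y_def)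
  qed
  then obtain a where a: "\<And>y i. y \<in> Y \<Longrightarrow> v y i = (\<Sum>x\<in>X. a y x * v x i)" by metis
  define A where "A x y = a y x" for x y
  have vA: "v y i = (\<Sum>x\<in>X. A x y * v x i)" if "y \<in> Y" for y i using a that by (simp add: A_def)
  have depA: "\<not> indep_in M' ((X - P) \<union> Q) \<longleftrightarrow>
    (\<exists>c. (\<exists>q\<in>Q. c q \<noteq> 0) \<and> (\<forall>p\<in>P. (\<Sum>q\<in>Q. c q * A p q) = 0))" if "P \<subseteq> X" "Q \<subseteq> Y" for P Q
  proof -
    have "(X - P) \<union> Q \<subseteq> ground M'" using that X E by (auto simp: Y_def)
    then show ?thesis unfolding v[OF \<open>(X - P) \<union> Q \<subseteq> ground M'\<close>]
      using that finY finite_subset by (intro dependent_iff_basis_coordinates fin vX vA) (auto simp: Y_def)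
  qed
  \<comment> \<open>If the set lies within \<open>X\<close>, then \<open>Q\<close> is empty and
    removing the nonempty \<open>P\<close> leaves a proper subset of the circuit, independent in
    both matroids.\<close>
  have same: "indep_in M' ((X - P) \<union> Q) \<longleftrightarrow> indep_in M ((X - P) \<union> Q)"
    if "P \<subseteq> X" "P \<noteq> {}" "Q \<subseteq> Y" for P Q
  proof -
    have "indep_in M ((X - P) \<union> Q)" if "(X - P) \<union> Q \<subseteq> X"
      using X(3)[of "(X - P) \<union> Q"] that \<open>P \<subseteq> X\<close> \<open>P \<noteq> {}\<close> \<open>Q \<subseteq> Y\<close> by (auto simp: Y_def)
    then show ?thesis using indep' by blast
  qed
  obtain d where d: "\<And>i. (\<Sum>x\<in>X. d x * w x i) = 0" "\<And>x. x \<in> X \<Longrightarrow> d x \<noteq> 0"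
    using M.circuit_relation[OF w circ] by blast
  have nspan: "\<not> (\<forall>i. w y i = (\<Sum>x\<in>X. a x * w x i))" if "y \<in> Y" for y a
    using M.circuit_hyperplane_not_span[OF w ch] that by (auto simp: Y_def)
  have liX: "lin_indep_fam w (X - {x})" if "x \<in> X" for x
    using X(3)[of "X - {x}"] w[of "X - {x}"] X(1) that by blast
  have "\<exists>B. compatible X Y A B"
  proof (cases "Y = {}")
    case True
    then show ?thesis by (auto simp: compatible_def)
  next
    case False
    then obtain y0 where y0: "y0 \<in> Y" by blast
    obtain z where z: "z \<in> X"
      using X(2) M.bases_nonempty unfolding indep_in_def by blast
    have "\<exists>t b. t \<noteq> 0 \<and> (\<forall>i. w y i = t * w y0 i + (\<Sum>x\<in>X. b x * w x i))" if y: "y \<in> Y" for y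
    proof (cases "y = y0")
      case True
      then show ?thesis by (intro exI[of _ 1] exI[of _ "\<lambda>_. 0"]) auto
    next
      case False
      let ?S = "(X - {z}) \<union> {y0, y}"
      have S: "?S \<subseteq> ground M" using X(1) y y0 by (auto simp: Y_def)
      define c where "c q = (if A z y = 0 \<and> A z y0 = 0 then 1 else if q = y0 then A z y else - A z y0)" for q
      have "(\<Sum>q\<in>{y0, y}. c q * A z q) = 0" using False by (auto simp: c_def algebra_simps)
      moreover have "\<exists>q\<in>{y0, y}. c q \<noteq> 0" using False by (auto simp: c_def)
      ultimately have "\<not> indep_in M' ?S"
        using depA[of "{z}" "{y0, y}"] z y y0 by auto
      then have "\<not> lin_indep_fam w ?S" using same[of "{z}" "{y0, y}"] z y y0 w[OF S] by auto
      then obtain c e where c: "\<And>i. (\<Sum>e\<in>?S. c e * w e i) = 0" and e: "e \<in> ?S" "c e \<noteq> 0"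
        by (rule not_lin_indep_famE) blast
      have yX: "y \<notin> X" "y0 \<notin> X" using y y0 by (auto simp: Y_def)
      have rel: "c y * w y i + c y0 * w y0 i + (\<Sum>x\<in>X - {z}. c x * w x i) = 0" for i
      proof -
        have "(\<Sum>e\<in>?S. c e * w e i) = (\<Sum>e\<in>X - {z}. c e * w e i) + (\<Sum>e\<in>{y0, y}. c e * w e i)"
          by (rule sum.union_disjoint) (use fin yX in auto)
        then show ?thesis using c[of i] False by (simp add: algebra_simps)
      qed
      have ext: "(\<Sum>x\<in>X - {z}. g x * w x i) = (\<Sum>x\<in>X. (if x = z then 0 else g x) * w x i)" for g i
        by (rule sum.mono_neutral_cong_left) (use fin in auto)
      \<comment> \<open>A relation involving only one of \<open>y0\<close> and \<open>y\<close>
        besides \<open>X\<close> would put that element into the span of \<open>X\<close>; hence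
        both coefficients are nonzero.\<close>
      have solve: False if u: "u \<in> Y" "h \<noteq> 0" "\<And>i. h * w u i + (\<Sum>x\<in>X - {z}. c x * w x i) = 0" for u h
      proof -
        have "w u i = (\<Sum>x\<in>X. (if x = z then 0 else - c x / h) * w x i)" for i
        proof -
          have "w u i = - (\<Sum>x\<in>X - {z}. c x * w x i) / h"
            using u(3)[of i] u(2) by (simp add: field_simps eq_neg_iff_add_eq_0)
          then show ?thesis unfolding ext[symmetric] by (simp add: sum_divide_distrib sum_negf)
        qed
        then show False using nspan[OF u(1), of "\<lambda>x. if x = z then 0 else - c x / h"] by simp
      qed
      have cy: "c y \<noteq> 0"
      proof
        assume cy: "c y = 0"
        then have "c y0 = 0" using solve[of y0 "c y0"] rel y0 by auto
        then have "(\<Sum>x\<in>X - {z}. c x * w x i) = 0" for i using rel[of i] cy by simp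
        from lin_indep_famD[OF liX[OF z] this] show False using e cy \<open>c y0 = 0\<close> by auto
      qed
      have cy0: "c y0 \<noteq> 0" using solve[of y "c y"] rel y cy by fastforce
      have "w y i = (- c y0 / c y) * w y0 i + (\<Sum>x\<in>X. (if x = z then 0 else - c x / c y) * w x i)" for i
      proof -
        have "w y i = (- c y0 * w y0 i - (\<Sum>x\<in>X - {z}. c x * w x i)) / c y"
          using rel[of i] cy by (simp add: field_simps eq_neg_iff_add_eq_0)
        then show ?thesis unfolding ext[symmetric]
          by (simp add: sum_divide_distrib sum_negf diff_divide_distrib)
      qed
      then show ?thesis using cy cy0 by (intro exI[of _ "- c y0 / c y"]) auto
    qed
    then obtain t b where tb: "\<And>y. y \<in> Y \<Longrightarrow> t y \<noteq> 0"
      "\<And>y i. y \<in> Y \<Longrightarrow> w y i = t y * w y0 i + (\<Sum>x\<in>X. b y x * w x i)" by metis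
    \<comment> \<open>Dividing by \<open>t y\<close> normalises the coefficient of
      \<open>w y0\<close> to one; dividing by \<open>d x\<close> makes all coefficients of the
      circuit relation equal.\<close>
    define B where "B x y = b y x / (t y * d x)" for x y
    have "compatible X Y A B"
      unfolding compatible_def
    proof (intro allI impI)
      fix P Q assume PQ: "P \<subseteq> X" "Q \<subseteq> Y" "P \<noteq> {}"
      have S: "(X - P) \<union> Q \<subseteq> ground M" using PQ X by (auto simp: Y_def)
      have fQ: "finite Q" using PQ finY finite_subset by blast
      have dis: "X \<inter> Q = {}" using PQ by (auto simp: Y_def)
      have wQ: "\<And>q i. q \<in> Q \<Longrightarrow> w q i = t q * w y0 i + (\<Sum>x\<in>X. b q x * w x i)"
        and tQ: "\<And>q. q \<in> Q \<Longrightarrow> t q \<noteq> 0" using tb PQ by auto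
      show "(\<exists>c. (\<exists>q\<in>Q. c q \<noteq> 0) \<and> (\<forall>p\<in>P. (\<Sum>q\<in>Q. c q * A p q) = 0)) \<longleftrightarrow>
        (\<exists>c. (\<exists>q\<in>Q. c q \<noteq> 0) \<and> (\<Sum>q\<in>Q. c q) = 0 \<and> (\<exists>k. \<forall>p\<in>P. (\<Sum>q\<in>Q. c q * B p q) = k))"
        unfolding B_def depA[OF PQ(1,2), symmetric] same[OF PQ(1,3,2)] w[OF S]
        by (rule dependent_iff_circuit_coordinates[OF fin fQ PQ(1,3) dis liX d nspan[OF y0] wQ tQ])
    qed
    then show ?thesis by blast
  qed
  then obtain B where "compatible X Y A B" by blast
  then show thesis using that[of A B v] v vA E by (simp add: Y_def)
qed

section \<open>Colourings without properly coloured cycles\<close>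

text \<open>\<open>g\<close> colours the edges of the complete bipartite graph on \<open>X\<close> and \<open>Y\<close>; a cycle is properly
  coloured if consecutive edges have different colours. \<open>hexagon_free\<close> excludes the colour pattern of
  properly coloured 6-cycles that does not already contain a properly coloured 4-cycle.\<close>

definition pc4_free :: "'a set \<Rightarrow> 'b set \<Rightarrow> ('a \<Rightarrow> 'b \<Rightarrow> 'c) \<Rightarrow> bool" where
  "pc4_free X Y g \<longleftrightarrow> (\<forall>x\<in>X. \<forall>x'\<in>X. \<forall>y\<in>Y. \<forall>y'\<in>Y.
    g x y = g x y' \<or> g x' y = g x' y' \<or> g x y = g x' y \<or> g x y' = g x' y')"

definition hexagon_free :: "'a set \<Rightarrow> 'b set \<Rightarrow> ('a \<Rightarrow> 'b \<Rightarrow> 'c) \<Rightarrow> bool" where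
  "hexagon_free X Y g \<longleftrightarrow> \<not> (\<exists>x\<in>X. \<exists>x'\<in>X. \<exists>x''\<in>X. \<exists>y\<in>Y. \<exists>y'\<in>Y. \<exists>y''\<in>Y. \<exists>p q r.
    p \<noteq> q \<and> q \<noteq> r \<and> p \<noteq> r \<and>
    g x y = p \<and> g x y' = p \<and> g x y'' = q \<and>
    g x' y = r \<and> g x' y' = q \<and> g x' y'' = q \<and>
    g x'' y = r \<and> g x'' y' = p \<and> g x'' y'' = r)"

definition row_const :: "'a \<Rightarrow> 'b set \<Rightarrow> ('a \<Rightarrow> 'b \<Rightarrow> 'c) \<Rightarrow> bool" where
  "row_const x Y g \<longleftrightarrow> (\<forall>y\<in>Y. \<forall>y'\<in>Y. g x y = g x y')"

definition col_const :: "'b \<Rightarrow> 'a set \<Rightarrow> ('a \<Rightarrow> 'b \<Rightarrow> 'c) \<Rightarrow> bool" where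
  "col_const y X g \<longleftrightarrow> (\<forall>x\<in>X. \<forall>x'\<in>X. g x y = g x' y)"

lemma pc4_freeD:
  "pc4_free X Y g \<Longrightarrow> x \<in> X \<Longrightarrow> x' \<in> X \<Longrightarrow> y \<in> Y \<Longrightarrow> y' \<in> Y \<Longrightarrow>
    g x y \<noteq> g x y' \<Longrightarrow> g x' y \<noteq> g x' y' \<Longrightarrow> g x y \<noteq> g x' y \<Longrightarrow> g x y' = g x' y'"
  unfolding pc4_free_def by blast

lemma pc4_free_subset: "pc4_free X Y g \<Longrightarrow> X' \<subseteq> X \<Longrightarrow> Y' \<subseteq> Y \<Longrightarrow> pc4_free X' Y' g"
  unfolding pc4_free_def by (meson subsetD)

lemma hexagon_free_subset: "hexagon_free X Y g \<Longrightarrow> X' \<subseteq> X \<Longrightarrow> Y' \<subseteq> Y \<Longrightarrow> hexagon_free X' Y' g"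
  unfolding hexagon_free_def by (meson subsetD)

lemma pc4_free_transpose: "pc4_free Y X (\<lambda>y x. g x y) \<longleftrightarrow> pc4_free X Y g"
  unfolding pc4_free_def by (intro iffI ballI; blast)

lemma hexagon_freeD:
  assumes "hexagon_free X Y g" "x \<in> X" "x' \<in> X" "x'' \<in> X" "y \<in> Y" "y' \<in> Y" "y'' \<in> Y"
    "p \<noteq> q" "q \<noteq> r" "p \<noteq> r" "g x y = p" "g x y' = p" "g x y'' = q"
    "g x' y = r" "g x' y' = q" "g x' y'' = q" "g x'' y = r" "g x'' y' = p" "g x'' y'' = r"
  shows False
  using assms unfolding hexagon_free_def by blast

text \<open>Having equal entries in row \<open>x\<close>, or in row \<open>x'\<close>, are two
  equivalence relations on the columns. Together they relate every pair, and two equivalence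
  relations can do so only if one of them is total.\<close>

lemma two_rows_const:
  assumes pc: "pc4_free {x, x'} Y g" and col: "\<And>y. y \<in> Y \<Longrightarrow> g x y \<noteq> g x' y"
  shows "row_const x Y g \<or> row_const x' Y g"
proof (rule ccontr)
  assume "\<not> ?thesis"
  then obtain y1 y2 y3 y4 where y: "y1 \<in> Y" "y2 \<in> Y" "y3 \<in> Y" "y4 \<in> Y"
    "g x y1 \<noteq> g x y2" "g x' y3 \<noteq> g x' y4" unfolding row_const_def by blast
  have eq: "g x u = g x w \<or> g x' u = g x' w" if "u \<in> Y" "w \<in> Y" for u w
    using pc4_freeD[OF pc, of x x' u w] that col by blast
  show False using eq y by metis
qed

text \<open>If no row and no column is constant, but deleting any vertex creates a constant one, then
  following ``the column that becomes constant without row \<open>x\<close>'' and ``the row that becomes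
  constant without column \<open>y\<close>'' alternately runs into a hexagon.\<close>

lemma const_row_or_col:
  assumes "finite X" "finite Y" "X \<noteq> {}" "Y \<noteq> {}" "pc4_free X Y g" "hexagon_free X Y g"
  shows "(\<exists>x\<in>X. row_const x Y g) \<or> (\<exists>y\<in>Y. col_const y X g)"
  using assms
proof (induction "card X + card Y" arbitrary: X Y rule: less_induct)
  case less
  note pc = pc4_freeD[OF less.prems(5)]
  show ?case
  proof (rule ccontr)
    assume neg: "\<not> ?case"
    then have norow: "\<not> row_const x Y g" if "x \<in> X" for x using that by blast
    from neg have nocol: "\<not> col_const y X g" if "y \<in> Y" for y using that by blast
    have X2: "X - {x} \<noteq> {}" if "x \<in> X" for x
    proof
      assume "X - {x} = {}"
      then have "X = {x}" using that by blast
      then show False using nocol less.prems(4) by (auto simp: col_const_def)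
    qed
    have Y2: "Y - {y} \<noteq> {}" if "y \<in> Y" for y
    proof
      assume "Y - {y} = {}"
      then have "Y = {y}" using that by blast
      then show False using norow less.prems(3) by (auto simp: row_const_def)
    qed
    \<comment> \<open>With only two rows, they would differ in every column, and one of them would
      be constant. The third row is needed for the injectivity of \<open>F\<close>.\<close>
    have X3: "\<exists>x\<in>X. x \<noteq> u \<and> x \<noteq> w" for u w
    proof (rule ccontr)
      assume "\<not> ?thesis"
      then have sub: "X \<subseteq> {u, w}" by blast
      obtain a where "a \<in> X" using less.prems(3) by blast
      moreover obtain b where "b \<in> X" "b \<noteq> a" using X2[OF \<open>a \<in> X\<close>] by blast
      ultimately have X: "X = {a, b}" using sub by auto
      have "g a y \<noteq> g b y" if "y \<in> Y" for y using nocol[OF that] unfolding col_const_def X by auto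
      then show False using two_rows_const[of a b Y g] less.prems(5) norow unfolding X by blast
    qed
    have Y3: "\<exists>y\<in>Y. y \<noteq> u \<and> y \<noteq> w" for u w
    proof (rule ccontr)
      assume "\<not> ?thesis"
      then have sub: "Y \<subseteq> {u, w}" by blast
      obtain a where "a \<in> Y" using less.prems(4) by blast
      moreover obtain b where "b \<in> Y" "b \<noteq> a" using Y2[OF \<open>a \<in> Y\<close>] by blast
      ultimately have Y: "Y = {a, b}" using sub by auto
      have "g x a \<noteq> g x b" if "x \<in> X" for x using norow[OF that] unfolding row_const_def Y by auto
      moreover have "pc4_free {a, b} X (\<lambda>y x. g x y)"
        using iffD2[OF pc4_free_transpose less.prems(5)] unfolding Y .
      ultimately have "row_const a X (\<lambda>y x. g x y) \<or> row_const b X (\<lambda>y x. g x y)"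
        by (intro two_rows_const) auto
      then show False using nocol[of a] nocol[of b] Y unfolding row_const_def col_const_def by blast
    qed
    \<comment> \<open>Deleting a row leaves the other rows intact and nonconstant, so the induction
      hypothesis must deliver a column.\<close>
    have "\<exists>y\<in>Y. col_const y (X - {x}) g" if x: "x \<in> X" for x
    proof -
      have "(\<exists>u\<in>X - {x}. row_const u Y g) \<or> (\<exists>y\<in>Y. col_const y (X - {x}) g)"
        using less.prems x X2 psubset_card_mono[of X "X - {x}"]
        by (intro less.hyps) (auto intro: pc4_free_subset hexagon_free_subset)
      then show ?thesis using norow by blast
    qed
    then obtain F where F: "\<And>x. x \<in> X \<Longrightarrow> F x \<in> Y" "\<And>x. x \<in> X \<Longrightarrow> col_const (F x) (X - {x}) g" by metis
    have "\<exists>x\<in>X. row_const x (Y - {y}) g" if y: "y \<in> Y" for y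
    proof -
      have "(\<exists>x\<in>X. row_const x (Y - {y}) g) \<or> (\<exists>w\<in>Y - {y}. col_const w X g)"
        using less.prems y Y2 psubset_card_mono[of Y "Y - {y}"]
        by (intro less.hyps) (auto intro: pc4_free_subset hexagon_free_subset)
      then show ?thesis using nocol by blast
    qed
    then obtain H where H: "\<And>y. y \<in> Y \<Longrightarrow> H y \<in> X" "\<And>y. y \<in> Y \<Longrightarrow> row_const (H y) (Y - {y}) g" by metis
    have "\<exists>a. \<forall>u\<in>X - {x}. g u (F x) = a" if "x \<in> X" for x
      using F(2)[OF that] X2[OF that] unfolding col_const_def by (metis ex_in_conv)
    then obtain a where a: "\<And>x u. x \<in> X \<Longrightarrow> u \<in> X \<Longrightarrow> u \<noteq> x \<Longrightarrow> g u (F x) = a x" by (metis DiffI singletonD)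
    have ax: "g x (F x) \<noteq> a x" if x: "x \<in> X" for x
    proof
      assume "g x (F x) = a x"
      then have "g u (F x) = a x" if "u \<in> X" for u using a x that by metis
      then have "col_const (F x) X g" by (simp add: col_const_def)
      then show False using nocol F(1) x by blast
    qed
    have "\<exists>b. \<forall>w\<in>Y - {y}. g (H y) w = b" if "y \<in> Y" for y
      using H(2)[OF that] Y2[OF that] unfolding row_const_def by (metis ex_in_conv)
    then obtain b where b: "\<And>y w. y \<in> Y \<Longrightarrow> w \<in> Y \<Longrightarrow> w \<noteq> y \<Longrightarrow> g (H y) w = b y" by (metis DiffI singletonD)
    have by': "g (H y) y \<noteq> b y" if y: "y \<in> Y" for y
    proof
      assume "g (H y) y = b y"
      then have "g (H y) w = b y" if "w \<in> Y" for w using b y that by metis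
      then have "row_const (H y) Y g" by (simp add: row_const_def)
      then show False using norow H(1) y by blast
    qed
    \<comment> \<open>Seen from a third row, a shared column has the same constant for
      \<open>x\<close> and \<open>x'\<close>; but \<open>x\<close> is exceptional in
      \<open>F x\<close> and not in \<open>F x'\<close>.\<close>
    have F_inj: "x = x'" if "x \<in> X" "x' \<in> X" "F x = F x'" for x x'
    proof (rule ccontr)
      assume ne: "x \<noteq> x'"
      obtain u where u: "u \<in> X" "u \<noteq> x" "u \<noteq> x'" using X3 by blast
      have "a x = a x'" using a[of x u] a[of x' u] u that by simp
      then show False using ax[of x] a[of x' x] that ne by simp
    qed
    have H_inj: "y = y'" if "y \<in> Y" "y' \<in> Y" "H y = H y'" for y y'
    proof (rule ccontr)
      assume ne: "y \<noteq> y'"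
      obtain u where u: "u \<in> Y" "u \<noteq> y" "u \<noteq> y'" using Y3 by blast
      have "b y = b y'" using b[of y u] b[of y' u] u that by simp
      then show False using by'[of y] b[of y' y] that ne by simp
    qed
    \<comment> \<open>Two rows fixed by \<open>H \<circ> F\<close> would span a properly coloured
      rectangle, so some row is moved.\<close>
    have mutual: "x = x'" if "x \<in> X" "x' \<in> X" "H (F x) = x" "H (F x') = x'" for x x'
    proof (rule ccontr)
      assume ne: "x \<noteq> x'"
      then have ne': "F x \<noteq> F x'" using F_inj that by blast
      have "g x (F x') = b (F x)" "g x (F x') = a x'" "g x' (F x) = b (F x')" "g x' (F x) = a x"
        using that ne ne' F(1) b[of "F x" "F x'"] b[of "F x'" "F x"] a by auto
      moreover have "g x (F x) \<noteq> b (F x)" "g x' (F x') \<noteq> b (F x')" using by' F that by metis+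
      moreover have "g x (F x) \<noteq> a x" "g x' (F x') \<noteq> a x'" using ax that by auto
      ultimately show False using pc[of x x' "F x" "F x'"] that F(1) by metis
    qed
    define s where "s x = H (F x)" for x
    have sX: "s x \<in> X" if "x \<in> X" for x using that F H by (simp add: s_def)
    have s_inj: "x = x'" if "x \<in> X" "x' \<in> X" "s x = s x'" for x x'
      using that F_inj H_inj F(1) unfolding s_def by blast
    obtain x1 where x1: "x1 \<in> X" "s x1 \<noteq> x1"
    proof -
      obtain u where u: "u \<in> X" using less.prems(3) by blast
      obtain u' where u': "u' \<in> X" "u' \<noteq> u" using X3 by blast
      show thesis using that[OF u] that[OF u'(1)] mutual[OF u u'(1)] u' unfolding s_def by blast
    qed
    \<comment> \<open>Injectivity keeps a moved row moving and so yields the walk \<open>x1\<close>,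
      \<open>x2\<close>, \<open>x3\<close>, \<open>x4\<close>, whose end may coincide with
      \<open>x1\<close>.\<close>
    have step: "s (s x) \<noteq> s x" if "x \<in> X" "s x \<noteq> x" for x using s_inj[of "s x" x] that sX by blast
    define x2 where "x2 = s x1"
    define x3 where "x3 = s x2"
    define x4 where "x4 = s x3"
    have X': "x2 \<in> X" "x3 \<in> X" "x4 \<in> X" using sX x1 by (auto simp: x2_def x3_def x4_def)
    have ne12: "x2 \<noteq> x1" using x1 by (simp add: x2_def)
    have ne23: "x3 \<noteq> x2" using step x1 by (simp add: x2_def x3_def)
    have ne34: "x4 \<noteq> x3" using step X' ne23 by (metis x3_def x4_def)
    define y1 where "y1 = F x1"
    define y2 where "y2 = F x2"
    define y3 where "y3 = F x3"
    define y4 where "y4 = F x4"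
    have Y': "y1 \<in> Y" "y2 \<in> Y" "y3 \<in> Y" "y4 \<in> Y" using F X' x1 by (auto simp: y1_def y2_def y3_def y4_def)
    have Hy: "H y1 = x2" "H y2 = x3" "H y3 = x4" by (auto simp: y1_def y2_def y3_def x2_def x3_def x4_def s_def)
    have ney: "y1 \<noteq> y2" "y2 \<noteq> y3" "y3 \<noteq> y4" using ne12 ne23 ne34 F_inj x1 X' by (auto simp: y1_def y2_def y3_def y4_def)
    have row2: "g x2 w = b y1" if "w \<in> Y" "w \<noteq> y1" for w using b[OF Y'(1) that] Hy by simp
    have row3: "g x3 w = b y2" if "w \<in> Y" "w \<noteq> y2" for w using b[OF Y'(2) that] Hy by simp
    have row4: "g x4 w = b y3" if "w \<in> Y" "w \<noteq> y3" for w using b[OF Y'(3) that] Hy by simp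
    have col1: "g u y1 = a x1" if "u \<in> X" "u \<noteq> x1" for u using a[OF x1(1) that] by (simp add: y1_def)
    have col2: "g u y2 = a x2" if "u \<in> X" "u \<noteq> x2" for u using a[OF X'(1) that] by (simp add: y2_def)
    have col3: "g u y3 = a x3" if "u \<in> X" "u \<noteq> x3" for u using a[OF X'(2) that] by (simp add: y3_def)
    have col4: "g u y4 = a x4" if "u \<in> X" "u \<noteq> x4" for u using a[OF X'(3) that] by (simp add: y4_def)
    have d1: "a x1 \<noteq> b y1" using by'[OF Y'(1)] Hy col1[of x2] ne12 X' by simp
    have d2: "a x2 \<noteq> b y2" using by'[OF Y'(2)] Hy col2[of x3] ne23 X' by simp
    have d3: "a x3 \<noteq> b y3" using by'[OF Y'(3)] Hy col3[of x4] ne34 X' by simp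
    have e2: "b y1 \<noteq> a x2" using ax[OF X'(1)] row2[of y2] ney Y' by (simp add: y2_def)
    have e3: "b y2 \<noteq> a x3" using ax[OF X'(2)] row3[of y3] ney Y' by (simp add: y3_def)
    have e4: "b y3 \<noteq> a x4" using ax[OF X'(3)] row4[of y4] ney Y' by (simp add: y4_def)
    \<comment> \<open>Returning after two steps would make rows \<open>x1\<close>, \<open>x2\<close>
      and columns \<open>y1\<close>, \<open>y2\<close> a properly coloured rectangle.\<close>
    have no2: "x3 \<noteq> x1"
    proof
      assume eq: "x3 = x1"
      have "g x1 y1 = b y2" using row3[of y1] Y' ney eq by auto
      moreover have "g x1 y2 = a x2" using col2[of x1] x1 ne12 by auto
      moreover have "g x2 y2 = b y1" using row2[of y2] Y' ney by auto
      moreover have "g x2 y1 = a x1" using col1[of x2] X' ne12 by auto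
      moreover have "b y2 \<noteq> a x1" using e3 eq by simp
      ultimately show False using pc[of x1 x2 y1 y2] x1 X' Y' d1 d2 e2 by metis
    qed
    have no3: "x4 \<noteq> x2"
      using s_inj[of x3 x1] X' x1 no2 by (auto simp: x4_def x2_def)
    have ney13: "y1 \<noteq> y3" using no2 F_inj x1 X' by (auto simp: y1_def y3_def)
    have ney24: "y2 \<noteq> y4" using no3 F_inj X' by (auto simp: y2_def y4_def)
    \<comment> \<open>Each of these entries is exceptional neither in its row nor in its column, so
      reading it both ways identifies two constants. The three colours \<open>a x1\<close>,
      \<open>a x2\<close>, \<open>a x3\<close> are distinct and fill the hexagon.\<close>
    have f1: "b y2 = a x1" using row3[of y1] col1[of x3] Y' X' ney no2 by auto
    have f2: "b y3 = a x2" using row4[of y2] col2[of x4] Y' X' ney no3 by auto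
    have f3: "b y1 = a x3" using row2[of y3] col3[of x2] Y' X' ney13 ne23 by auto
    have f4: "b y2 = a x4" using row3[of y4] col4[of x3] Y' X' ney24 ne34 by auto
    have "g x2 y3 = a x3" "g x2 y2 = a x3" "g x2 y1 = a x1"
      using row2 col1 Y' X' ney ney13 f3 ne12 by auto
    moreover have "g x3 y3 = a x1" "g x3 y2 = a x2" "g x3 y1 = a x1"
      using row3 col2 Y' X' ney ney13 f1 ne23 by auto
    moreover have "g x4 y3 = a x3" "g x4 y2 = a x2"
      using row4 col3 Y' X' ney f2 ne34 by auto
    moreover have "g x4 y1 = a x2" using row4[of y1] Y' ney13 f2 by auto
    ultimately show False
      using hexagon_freeD[OF less.prems(6), of x2 x3 x4 y2 y3 y1 "a x3" "a x1" "a x2"]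
        X' Y' d1 d2 d3 e2 e3 e4 f1 f2 f3 by metis
  qed
qed

section \<open>Path width from a colouring\<close>

text \<open>Constancy on the current remainder survives all later removals, so the conditions hold
  for every prefix at once.\<close>

lemma elimination_order:
  fixes X Y :: "'a set"
  assumes "finite X" "finite Y" "X \<inter> Y = {}" "pc4_free X Y g" "hexagon_free X Y g"
  obtains es where "distinct es" "set es = X \<union> Y"
    "\<And>t x. x \<in> X \<inter> set (take t es) \<Longrightarrow> row_const x (Y - set (take t es)) g"
    "\<And>t y. y \<in> Y \<inter> set (take t es) \<Longrightarrow> col_const y (X - set (take t es)) g"
proof -
  have "\<exists>es. distinct es \<and> set es = X \<union> Y \<and>
    (\<forall>t. (\<forall>x \<in> X \<inter> set (take t es). row_const x (Y - set (take t es)) g) \<and>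
         (\<forall>y \<in> Y \<inter> set (take t es). col_const y (X - set (take t es)) g))"
    using assms
  proof (induction "card (X \<union> Y)" arbitrary: X Y)
    case 0
    then show ?case by (intro exI[of _ "[]"]) auto
  next
    case (Suc n)
    have "\<exists>v \<in> X \<union> Y. (v \<in> X \<longrightarrow> row_const v Y g) \<and> (v \<in> Y \<longrightarrow> col_const v X g)"
    proof (cases "X = {} \<or> Y = {}")
      case True
      \<comment> \<open>Once one side is empty, every remaining vertex is vacuously
        constant.\<close>
      have "X \<union> Y \<noteq> {}" using Suc.hyps(2) by auto
      then show ?thesis using True by (auto simp: row_const_def col_const_def)
    next
      case False
      then show ?thesis using const_row_or_col[of X Y g] Suc.prems by blast
    qed
    then obtain v where v: "v \<in> X \<union> Y" "v \<in> X \<Longrightarrow> row_const v Y g" "v \<in> Y \<Longrightarrow> col_const v X g" by blast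
    have "n = card ((X - {v}) \<union> (Y - {v}))"
    proof -
      have "(X - {v}) \<union> (Y - {v}) = (X \<union> Y) - {v}" by blast
      then show ?thesis using Suc.hyps(2) v(1) Suc.prems by (simp add: card_Diff_singleton)
    qed
    moreover have disj: "(X - {v}) \<inter> (Y - {v}) = {}" using Suc.prems by blast
    moreover have "pc4_free (X - {v}) (Y - {v}) g" "hexagon_free (X - {v}) (Y - {v}) g"
      using Suc.prems by (auto intro: pc4_free_subset hexagon_free_subset)
    ultimately have "\<exists>es. distinct es \<and> set es = (X - {v}) \<union> (Y - {v}) \<and>
      (\<forall>t. (\<forall>x \<in> (X - {v}) \<inter> set (take t es). row_const x ((Y - {v}) - set (take t es)) g) \<and>
           (\<forall>y \<in> (Y - {v}) \<inter> set (take t es). col_const y ((X - {v}) - set (take t es)) g))"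
      using Suc.prems by (intro Suc.hyps(1)) auto
    then obtain es where es: "distinct es" "set es = (X - {v}) \<union> (Y - {v})" and
      later: "\<forall>t. (\<forall>x \<in> (X - {v}) \<inter> set (take t es). row_const x ((Y - {v}) - set (take t es)) g) \<and>
           (\<forall>y \<in> (Y - {v}) \<inter> set (take t es). col_const y ((X - {v}) - set (take t es)) g)"
      by (elim exE conjE)
    note row_later = bspec[OF conjunct1[OF spec[OF later]]]
    note col_later = bspec[OF conjunct2[OF spec[OF later]]]
    have "row_const x (Y - set (take t (v # es))) g" if "x \<in> X \<inter> set (take t (v # es))" for x t
    proof (cases t)
      case (Suc s)
      have "Y - set (take t (v # es)) = (Y - {v}) - set (take s es)" using Suc by auto
      moreover have "x = v \<or> x \<in> (X - {v}) \<inter> set (take s es)" using that Suc by auto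
      ultimately show ?thesis using row_later[of x s] v(2) that by (auto simp: row_const_def)
    qed (use that in simp)
    moreover have "col_const y (X - set (take t (v # es))) g" if "y \<in> Y \<inter> set (take t (v # es))" for y t
    proof (cases t)
      case (Suc s)
      have "X - set (take t (v # es)) = (X - {v}) - set (take s es)" using Suc by auto
      moreover have "y = v \<or> y \<in> (Y - {v}) \<inter> set (take s es)" using that Suc by auto
      ultimately show ?thesis using col_later[of y s] v(3) that by (auto simp: col_const_def)
    qed (use that in simp)
    ultimately show ?case using es(1,2) v(1) by (intro exI[of _ "v # es"]) auto
  qed
  then show thesis using that by blast
qed

text \<open>Modulo the basis vectors in \<open>X \<inter> W\<close>, every member of
  \<open>W\<close> is a multiple of the single vector with coordinates \<open>h\<close> on
  \<open>X - W\<close>.\<close>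

lemma (in matroid) rk_le_of_rank_one_block:
  fixes v :: "'a \<Rightarrow> nat \<Rightarrow> 'f::field"
  assumes v: "\<And>S. S \<subseteq> ground M \<Longrightarrow> indep_in M S \<longleftrightarrow> lin_indep_fam v S"
    and X: "X \<subseteq> ground M"
    and A: "\<And>y i. y \<in> ground M - X \<Longrightarrow> v y i = (\<Sum>x\<in>X. A x y * v x i)"
    and W: "W \<subseteq> ground M"
    and block: "\<And>y. y \<in> W - X \<Longrightarrow> \<exists>k. \<forall>x\<in>X - W. A x y = k * h x"
  shows "rk M W \<le> card (X \<inter> W) + 1"
proof (rule rk_le)
  fix I assume I: "indep_in M I" "I \<subseteq> W"
  have IE: "I \<subseteq> ground M" using I indep_in_ground by blast
  have finX: "finite X" using X finite_ground finite_subset by blast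
  \<comment> \<open>\<open>None\<close> indexes that additional vector.\<close>
  define T where "T = insert None (Some ` (X \<inter> W))"
  define u where "u t = (case t of None \<Rightarrow> (\<lambda>i. \<Sum>x\<in>X - W. h x * v x i) | Some x \<Rightarrow> v x)" for t
  have sumT: "(\<Sum>t\<in>T. a t * u t i) = a None * (\<Sum>x\<in>X - W. h x * v x i) + (\<Sum>x\<in>X \<inter> W. a (Some x) * v x i)"
    for a i
    using finX by (simp add: T_def u_def sum.reindex)
  have "\<exists>a. \<forall>i. v e i = (\<Sum>t\<in>T. a t * u t i)" if e: "e \<in> I" for e
  proof (cases "e \<in> X")
    case True
    have "v e i = (\<Sum>t\<in>T. (if t = Some e then 1 else 0) * u t i)" for i
      unfolding sumT using finX True subsetD[OF I(2) e]
      by (simp add: if_distrib[of "\<lambda>u. u * _"] sum.delta cong: if_cong)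
    then show ?thesis by (intro exI[of _ "\<lambda>t. if t = Some e then 1 else 0"]) simp
  next
    case False
    then obtain k where k: "\<forall>x\<in>X - W. A x e = k * h x" using block e I by blast
    have "v e i = (\<Sum>t\<in>T. (case t of None \<Rightarrow> k | Some x \<Rightarrow> A x e) * u t i)" for i
    proof -
      have "v e i = (\<Sum>x\<in>X \<inter> W. A x e * v x i) + (\<Sum>x\<in>X - W. A x e * v x i)"
        using A[of e i] False e IE sum.Int_Diff[OF finX, of "\<lambda>x. A x e * v x i" W] by auto
      also have "(\<Sum>x\<in>X - W. A x e * v x i) = k * (\<Sum>x\<in>X - W. h x * v x i)"
        using k by (simp add: sum_distrib_left mult.assoc)
      finally show ?thesis unfolding sumT by simp
    qed
    then show ?thesis by (intro exI[of _ "\<lambda>t. case t of None \<Rightarrow> k | Some x \<Rightarrow> A x e"]) simp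
  qed
  then have "card I \<le> card T"
    using card_le_of_lin_indep_fam[of v I T u] v[OF IE] I finX IE finite_ground
    by (auto simp: T_def intro: finite_subset)
  also have "card T \<le> card (X \<inter> W) + 1"
    using finX by (simp add: T_def card_image)
  finally show "card I \<le> card (X \<inter> W) + 1" .
qed

text \<open>The rank bounds for a prefix \<open>Z\<close> and its complement add up to
  \<open>card X + 2\<close>, which is at most the rank plus 2.\<close>

lemma (in matroid) path_width_three_of_coloring:
  fixes v :: "'a \<Rightarrow> nat \<Rightarrow> 'f::field"
  assumes v: "\<And>S. S \<subseteq> ground M \<Longrightarrow> indep_in M S \<longleftrightarrow> lin_indep_fam v S"
    and X: "X \<in> bases M"
    and A: "\<And>y i. y \<in> ground M - X \<Longrightarrow> v y i = (\<Sum>x\<in>X. A x y * v x i)"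
    and scale: "\<And>x y. x \<in> X \<Longrightarrow> y \<in> ground M - X \<Longrightarrow> A x y = g x y * r x * s y"
    and g: "pc4_free X (ground M - X) g" "hexagon_free X (ground M - X) g"
  shows "path_width_three M"
proof -
  have XE: "X \<subseteq> ground M" using X bases_subset by blast
  have finX: "finite X" using XE finite_ground finite_subset by blast
  obtain es where es: "distinct es" "set es = X \<union> (ground M - X)"
    "\<And>t x. x \<in> X \<inter> set (take t es) \<Longrightarrow> row_const x (ground M - X - set (take t es)) g"
    "\<And>t y. y \<in> (ground M - X) \<inter> set (take t es) \<Longrightarrow> col_const y (X - set (take t es)) g"
    using elimination_order[OF finX _ _ g] finite_ground by blast
  have "three_separating M (set (take t es))" for t
  proof -
    define Z where "Z = set (take t es)"
    have Z: "Z \<subseteq> ground M" using es(2) XE set_take_subset[of t es] by (auto simp: Z_def)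
    have "rk M Z \<le> card (X \<inter> Z) + 1"
    proof (rule rk_le_of_rank_one_block[OF v XE A Z, of r])
      fix y assume y: "y \<in> Z - X"
      have c: "col_const y (X - Z) g" using es(4)[of y t] y Z by (auto simp: Z_def)
      have "\<exists>k. \<forall>x\<in>X - Z. g x y = k" using c unfolding col_const_def by metis
      then obtain k where "\<forall>x\<in>X - Z. g x y = k" by blast
      then show "\<exists>k. \<forall>x\<in>X - Z. A x y = k * r x"
        using scale y Z by (intro exI[of _ "k * s y"]) auto
    qed auto
    moreover have "rk M (ground M - Z) \<le> card (X \<inter> (ground M - Z)) + 1"
    proof -
      have "\<forall>x\<in>X \<inter> Z. \<exists>k. \<forall>y\<in>ground M - X - Z. g x y = k"
        using es(3)[of _ t] unfolding row_const_def Z_def by metis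
      then obtain k where k: "\<And>x y. x \<in> X \<inter> Z \<Longrightarrow> y \<in> ground M - X - Z \<Longrightarrow> g x y = k x" by metis
      show ?thesis
      \<comment> \<open>Here the removed rows are constant on the remaining columns, so the
        direction \<open>k x * r x\<close> is common to all these columns.\<close>
      proof (rule rk_le_of_rank_one_block[OF v XE A, of "ground M - Z" "\<lambda>x. k x * r x"])
        fix y assume "y \<in> ground M - Z - X"
        then show "\<exists>c. \<forall>x\<in>X - (ground M - Z). A x y = c * (k x * r x)"
          using scale k XE by (intro exI[of _ "s y"]) auto
      qed auto
    qed
    moreover have "card X \<le> rk M (ground M)"
      using X XE by (intro card_le_rk) (auto simp: indep_in_def)
    moreover have "card X = card (X \<inter> Z) + card (X \<inter> (ground M - Z))"
    proof -
      have "X \<inter> (ground M - Z) = X - Z" using XE by blast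
      then show ?thesis using card_Int_Diff[OF finX, of Z] by simp
    qed
    ultimately show ?thesis unfolding three_separating_def Z_def[symmetric] by linarith
  qed
  moreover have "set es = ground M" using es(2) XE by blast
  ultimately show ?thesis using es(1) unfolding path_width_three_def by blast
qed

section \<open>Compatible matrices over the field with four elements\<close>

lemma gf4_all: "(\<forall>x::gf4. P x) \<longleftrightarrow>
    P (GF4 False False) \<and> P (GF4 True False) \<and> P (GF4 False True) \<and> P (GF4 True True)"
  by (metis (full_types) gf4.exhaust)

lemma gf4_ex: "(\<exists>x::gf4. P x) \<longleftrightarrow>
    P (GF4 False False) \<or> P (GF4 True False) \<or> P (GF4 False True) \<or> P (GF4 True True)"
  by (metis (full_types) gf4.exhaust)

text \<open>Simplification collects repeated summands into numerals; these equations make such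
  numerals computable.\<close>

lemma gf4_two: "(2::gf4) = 0" and gf4_three: "(3::gf4) = 1"
proof -
  have "(1::gf4) + 1 = 0" by (simp only: one_gf4_def zero_gf4_def plus_gf4.simps) simp
  then show "(2::gf4) = 0" by simp
  then show "(3::gf4) = 1" using numeral_plus_one[of "Num.num.Bit0 Num.num.One", where 'a = gf4] by simp
qed

lemmas gf4_eval = gf4_all gf4_ex gf4_two gf4_three zero_gf4_def one_gf4_def uminus_gf4_def minus_gf4_def
  inverse_gf4_def divide_gf4_def

lemma gf4_add_self [simp]: "x + x = (0::gf4)"
proof -
  have "x + x = 2 * x" by simp
  then show ?thesis by (simp add: gf4_two)
qed

lemma gf4_add_eq_0_iff: "x + y = 0 \<longleftrightarrow> x = (y::gf4)"
  using gf4_add_self[of y] by (metis add_right_cancel)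

lemma gf4_three_values:
  fixes a b c x :: gf4
  assumes "a \<noteq> 0" "b \<noteq> 0" "c \<noteq> 0" "a \<noteq> b" "b \<noteq> c" "a \<noteq> c" "x \<noteq> 0"
  shows "x = a \<or> x = b \<or> x = c"
proof -
  have "\<forall>a b c x :: gf4. a \<noteq> 0 \<longrightarrow> b \<noteq> 0 \<longrightarrow> c \<noteq> 0 \<longrightarrow> a \<noteq> b \<longrightarrow> b \<noteq> c \<longrightarrow> a \<noteq> c \<longrightarrow> x \<noteq> 0 \<longrightarrow>
    x = a \<or> x = b \<or> x = c"
    by (simp add: gf4_eval)
  then show ?thesis using assms by blast
qed

section \<open>Small minors and rescalings of compatible matrices\<close>

lemma compatibleD:
  assumes "compatible X Y A B" "P \<subseteq> X" "P \<noteq> {}" "Q \<subseteq> Y"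
  shows "(\<exists>c. (\<exists>q\<in>Q. c q \<noteq> 0) \<and> (\<forall>p\<in>P. (\<Sum>q\<in>Q. c q * A p q) = 0)) \<longleftrightarrow>
    (\<exists>c. (\<exists>q\<in>Q. c q \<noteq> 0) \<and> (\<Sum>q\<in>Q. c q) = 0 \<and> (\<exists>k. \<forall>p\<in>P. (\<Sum>q\<in>Q. c q * B p q) = k))"
  using assms unfolding compatible_def by blast

text \<open>The bordered minor of a single entry is -1, whatever the entry of
  \<open>B\<close>.\<close>

lemma compatible_nonzero:
  assumes "compatible X Y A B" "x \<in> X" "y \<in> Y"
  shows "A x y \<noteq> 0"
proof
  assume "A x y = 0"
  then have "\<exists>c. (\<exists>q\<in>{y}. c q \<noteq> 0) \<and> (\<forall>p\<in>{x}. (\<Sum>q\<in>{y}. c q * A p q) = 0)"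
    by (intro exI[of _ "\<lambda>_. 1"]) simp
  then show False using compatibleD[OF assms(1), of "{x}" "{y}"] assms(2,3) by auto
qed

text \<open>Repeated rows only repeat conditions, so \<open>r\<close> may fail to be injective;
  chains that return to a row are covered.\<close>

lemma compatible_reindex:
  assumes "compatible X Y A B" "r ` I \<subseteq> X"
  shows "compatible I Y (\<lambda>i. A (r i)) (\<lambda>i. B (r i))"
  unfolding compatible_def
proof (intro allI impI)
  fix P Q assume "P \<subseteq> I" "Q \<subseteq> Y" "P \<noteq> {}"
  then have "r ` P \<subseteq> X" "r ` P \<noteq> {}" "Q \<subseteq> Y" using assms(2) by auto
  from compatibleD[OF assms(1) this]
  show "(\<exists>c. (\<exists>q\<in>Q. c q \<noteq> 0) \<and> (\<forall>p\<in>P. (\<Sum>q\<in>Q. c q * A (r p) q) = 0)) \<longleftrightarrow>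
    (\<exists>c. (\<exists>q\<in>Q. c q \<noteq> 0) \<and> (\<Sum>q\<in>Q. c q) = 0 \<and> (\<exists>k. \<forall>p\<in>P. (\<Sum>q\<in>Q. c q * B (r p) q) = k))"
    by (simp only: ball_simps)
qed

text \<open>Column scalings are absorbed into the coefficients and row scalings cancel. Since the
  coefficients of \<open>B\<close> sum to zero, row translations vanish and column translations only
  shift the common value.\<close>

lemma compatible_gauge:
  assumes comp: "compatible X Y A B"
    and A: "\<And>x y. x \<in> X \<Longrightarrow> y \<in> Y \<Longrightarrow> A x y = g x y * r x * s y"
    and r: "\<And>x. x \<in> X \<Longrightarrow> r x \<noteq> 0" and s: "\<And>y. y \<in> Y \<Longrightarrow> s y \<noteq> 0"
    and B: "\<And>x y. x \<in> X \<Longrightarrow> y \<in> Y \<Longrightarrow> B x y = h x y + k x + l y"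
  shows "compatible X Y g h"
  unfolding compatible_def
proof (intro allI impI)
  fix P Q assume PQ: "P \<subseteq> X" "Q \<subseteq> Y" "P \<noteq> {}"
  have sA: "(\<Sum>q\<in>Q. c q * A p q) = r p * (\<Sum>q\<in>Q. (c q * s q) * g p q)" if "p \<in> P" for p c
    unfolding sum_distrib_left
    by (rule sum.cong[OF refl]) (simp add: A[OF subsetD[OF PQ(1) that] subsetD[OF PQ(2)]] mult_ac)
  have sB: "(\<Sum>q\<in>Q. c q * B p q) = (\<Sum>q\<in>Q. c q * h p q) + (\<Sum>q\<in>Q. c q * l q)"
    if p: "p \<in> P" and c: "(\<Sum>q\<in>Q. c q) = 0" for p c
  proof -
    have "(\<Sum>q\<in>Q. c q * B p q) = (\<Sum>q\<in>Q. c q * h p q + c q * k p + c q * l q)"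
      by (rule sum.cong[OF refl]) (simp add: B[OF subsetD[OF PQ(1) p] subsetD[OF PQ(2)]] distrib_left)
    also have "\<dots> = (\<Sum>q\<in>Q. c q * h p q) + (\<Sum>q\<in>Q. c q) * k p + (\<Sum>q\<in>Q. c q * l q)"
      by (simp add: sum.distrib sum_distrib_right)
    finally show ?thesis using c by simp
  qed
  have gA: "(\<exists>c. (\<exists>q\<in>Q. c q \<noteq> 0) \<and> (\<forall>p\<in>P. (\<Sum>q\<in>Q. c q * A p q) = 0)) \<longleftrightarrow>
    (\<exists>c. (\<exists>q\<in>Q. c q \<noteq> 0) \<and> (\<forall>p\<in>P. (\<Sum>q\<in>Q. c q * g p q) = 0))"
  proof
    assume "\<exists>c. (\<exists>q\<in>Q. c q \<noteq> 0) \<and> (\<forall>p\<in>P. (\<Sum>q\<in>Q. c q * A p q) = 0)"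
    then obtain c q where c: "q \<in> Q" "c q \<noteq> 0" "\<And>p. p \<in> P \<Longrightarrow> (\<Sum>q\<in>Q. c q * A p q) = 0" by blast
    have "(\<Sum>q\<in>Q. (c q * s q) * g p q) = 0" if "p \<in> P" for p
      using c(3)[OF that] sA[OF that] r that PQ by auto
    then show "\<exists>c. (\<exists>q\<in>Q. c q \<noteq> 0) \<and> (\<forall>p\<in>P. (\<Sum>q\<in>Q. c q * g p q) = 0)"
      using c(1,2) s[OF subsetD[OF PQ(2) c(1)]] by (intro exI[of _ "\<lambda>q. c q * s q"]) (auto intro!: bexI[of _ q])
  next
    assume "\<exists>c. (\<exists>q\<in>Q. c q \<noteq> 0) \<and> (\<forall>p\<in>P. (\<Sum>q\<in>Q. c q * g p q) = 0)"
    then obtain c q where c: "q \<in> Q" "c q \<noteq> 0" "\<And>p. p \<in> P \<Longrightarrow> (\<Sum>q\<in>Q. c q * g p q) = 0" by blast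
    have "(\<Sum>q\<in>Q. c q / s q * A p q) = 0" if "p \<in> P" for p
    proof -
      have "(\<Sum>q\<in>Q. (c q / s q * s q) * g p q) = (\<Sum>q\<in>Q. c q * g p q)"
        by (rule sum.cong) (use s PQ in auto)
      then show ?thesis using sA[OF that, of "\<lambda>q. c q / s q"] c(3)[OF that] by simp
    qed
    then show "\<exists>c. (\<exists>q\<in>Q. c q \<noteq> 0) \<and> (\<forall>p\<in>P. (\<Sum>q\<in>Q. c q * A p q) = 0)"
      using c(1,2) s[OF subsetD[OF PQ(2) c(1)]] by (intro exI[of _ "\<lambda>q. c q / s q"]) (auto intro!: bexI[of _ q])
  qed
  have hB: "(\<exists>k. \<forall>p\<in>P. (\<Sum>q\<in>Q. c q * B p q) = k) \<longleftrightarrow> (\<exists>k. \<forall>p\<in>P. (\<Sum>q\<in>Q. c q * h p q) = k)"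
    if "(\<Sum>q\<in>Q. c q) = 0" for c
  proof
    assume "\<exists>k. \<forall>p\<in>P. (\<Sum>q\<in>Q. c q * B p q) = k"
    then obtain k where "\<forall>p\<in>P. (\<Sum>q\<in>Q. c q * B p q) = k" by blast
    then show "\<exists>k. \<forall>p\<in>P. (\<Sum>q\<in>Q. c q * h p q) = k"
      using sB[OF _ that] by (intro exI[of _ "k - (\<Sum>q\<in>Q. c q * l q)"]) (simp add: eq_diff_eq)
  next
    assume "\<exists>k. \<forall>p\<in>P. (\<Sum>q\<in>Q. c q * h p q) = k"
    then obtain k where "\<forall>p\<in>P. (\<Sum>q\<in>Q. c q * h p q) = k" by blast
    then show "\<exists>k. \<forall>p\<in>P. (\<Sum>q\<in>Q. c q * B p q) = k"
      using sB[OF _ that] by (intro exI[of _ "k + (\<Sum>q\<in>Q. c q * l q)"]) simp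
  qed
  have "(\<exists>c. (\<exists>q\<in>Q. c q \<noteq> 0) \<and> (\<Sum>q\<in>Q. c q) = 0 \<and> (\<exists>k. \<forall>p\<in>P. (\<Sum>q\<in>Q. c q * B p q) = k)) \<longleftrightarrow>
    (\<exists>c. (\<exists>q\<in>Q. c q \<noteq> 0) \<and> (\<Sum>q\<in>Q. c q) = 0 \<and> (\<exists>k. \<forall>p\<in>P. (\<Sum>q\<in>Q. c q * h p q) = k))"
    by (rule ex_cong1, rule conj_cong[OF refl], rule conj_cong[OF refl], rule hB)
  then show "(\<exists>c. (\<exists>q\<in>Q. c q \<noteq> 0) \<and> (\<forall>p\<in>P. (\<Sum>q\<in>Q. c q * g p q) = 0)) \<longleftrightarrow>
    (\<exists>c. (\<exists>q\<in>Q. c q \<noteq> 0) \<and> (\<Sum>q\<in>Q. c q) = 0 \<and> (\<exists>k. \<forall>p\<in>P. (\<Sum>q\<in>Q. c q * h p q) = k))"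
    using compatibleD[OF comp PQ(1,3,2)] gA by (simp only:)
qed

lemma ex_fun_pair:
  assumes "y \<noteq> y'"
  shows "(\<exists>c. P (c y) (c y')) \<longleftrightarrow> (\<exists>e f. P e f)"
proof
  assume "\<exists>e f. P e f"
  then obtain e f where "P e f" by blast
  then show "\<exists>c. P (c y) (c y')"
    using assms by (intro exI[of _ "\<lambda>z. if z = y then e else f"]) simp
qed blast

lemma ex_fun_triple:
  assumes "y \<noteq> y'" "y' \<noteq> y''" "y \<noteq> y''"
  shows "(\<exists>c. P (c y) (c y') (c y'')) \<longleftrightarrow> (\<exists>e f h. P e f h)"
proof
  assume "\<exists>e f h. P e f h"
  then obtain e f h where "P e f h" by blast
  then show "\<exists>c. P (c y) (c y') (c y'')"
    using assms by (intro exI[of _ "\<lambda>z. if z = y then e else if z = y' then f else h"]) simp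
qed blast

lemma compatible_pair:
  assumes comp: "compatible X Y A B" and "x \<in> X" "x' \<in> X" "y \<in> Y" "y' \<in> Y" and dist: "y \<noteq> y'"
  shows "(\<exists>e f. (e \<noteq> 0 \<or> f \<noteq> 0) \<and> e * A x y + f * A x y' = 0 \<and> e * A x' y + f * A x' y' = 0) \<longleftrightarrow>
    (\<exists>e f. (e \<noteq> 0 \<or> f \<noteq> 0) \<and> e + f = 0 \<and>
      (\<exists>k. e * B x y + f * B x y' = k \<and> e * B x' y + f * B x' y' = k))"
    (is "(\<exists>e f. ?L e f) \<longleftrightarrow> (\<exists>e f. ?R e f)")
proof -
  have "(\<exists>c. (\<exists>q\<in>{y, y'}. c q \<noteq> 0) \<and> (\<forall>p\<in>{x, x'}. (\<Sum>q\<in>{y, y'}. c q * A p q) = 0)) \<longleftrightarrow>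
    (\<exists>c. (\<exists>q\<in>{y, y'}. c q \<noteq> 0) \<and> (\<Sum>q\<in>{y, y'}. c q) = 0 \<and>
      (\<exists>k. \<forall>p\<in>{x, x'}. (\<Sum>q\<in>{y, y'}. c q * B p q) = k))"
    by (rule compatibleD[OF comp]) (use assms in auto)
  then have "(\<exists>c. ?L (c y) (c y')) \<longleftrightarrow> (\<exists>c. ?R (c y) (c y'))"
    using dist by simp
  then show ?thesis unfolding ex_fun_pair[OF dist, of ?L] ex_fun_pair[OF dist, of ?R] .
qed

text \<open>For two columns the coefficients are forced up to a factor: \<open>A x y'\<close> and
  \<open>- A x y\<close> on one side, 1 and -1 on the other.\<close>

lemma compatible_pair_det:
  assumes comp: "compatible X Y A B" and xy: "x \<in> X" "x' \<in> X" "y \<in> Y" "y' \<in> Y" and dist: "y \<noteq> y'"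
  shows "A x y * A x' y' = A x y' * A x' y \<longleftrightarrow> B x y - B x y' = B x' y - B x' y'"
proof -
  have nz: "A x y \<noteq> 0" "A x y' \<noteq> 0" "A x' y \<noteq> 0" "A x' y' \<noteq> 0"
    using compatible_nonzero[OF comp] xy by auto
  have kernel: "A x y * A x' y' = A x y' * A x' y"
    if "e \<noteq> 0 \<or> f \<noteq> 0" "e * A x y + f * A x y' = 0" "e * A x' y + f * A x' y' = 0" for e f
  proof -
    have f: "e * A x y = - f * A x y'" "e * A x' y = - f * A x' y'"
      using that by (auto simp: eq_neg_iff_add_eq_0)
    then have "e \<noteq> 0" using that(1) nz by auto
    have "e * (A x y * A x' y') = e * (A x y' * A x' y)"
      using f by (metis mult.left_commute mult.assoc mult.commute)
    then show ?thesis using \<open>e \<noteq> 0\<close> by simp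
  qed
  have diff: "B x y - B x y' = B x' y - B x' y'"
    if "e \<noteq> 0 \<or> f \<noteq> 0" "e + f = 0" "e * B x y + f * B x y' = k \<and> e * B x' y + f * B x' y' = k" for e f k
  proof -
    have f: "f = - e" using that(2) by (simp add: eq_neg_iff_add_eq_0 add.commute)
    then have "e * (B x y - B x y') = e * (B x' y - B x' y')" using that(3) by (simp add: algebra_simps)
    then show ?thesis using that(1) f by simp
  qed
  show ?thesis
  proof
    assume det: "A x y * A x' y' = A x y' * A x' y"
    have "\<exists>e f. (e \<noteq> 0 \<or> f \<noteq> 0) \<and> e * A x y + f * A x y' = 0 \<and> e * A x' y + f * A x' y' = 0"
      using nz det by (intro exI[of _ "A x y'"] exI[of _ "- A x y"]) (simp add: mult.commute)
    then show "B x y - B x y' = B x' y - B x' y'"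
      using compatible_pair[OF comp xy dist] diff by blast
  next
    assume "B x y - B x y' = B x' y - B x' y'"
    then have "\<exists>e f. (e \<noteq> 0 \<or> f \<noteq> 0) \<and> e + f = 0 \<and>
        (\<exists>k. e * B x y + f * B x y' = k \<and> e * B x' y + f * B x' y' = k)"
      by (intro exI[of _ 1] exI[of _ "- 1"]) simp
    then show "A x y * A x' y' = A x y' * A x' y"
      using compatible_pair[OF comp xy dist] kernel by blast
  qed
qed

lemma compatible_triple:
  assumes comp: "compatible X Y A B"
    and "x \<in> X" "x' \<in> X" "x'' \<in> X" "y \<in> Y" "y' \<in> Y" "y'' \<in> Y" and dist: "y \<noteq> y'" "y' \<noteq> y''" "y \<noteq> y''"
  shows "(\<exists>e f h. (e \<noteq> 0 \<or> f \<noteq> 0 \<or> h \<noteq> 0) \<and> e * A x y + (f * A x y' + h * A x y'') = 0 \<and>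
      e * A x' y + (f * A x' y' + h * A x' y'') = 0 \<and> e * A x'' y + (f * A x'' y' + h * A x'' y'') = 0) \<longleftrightarrow>
    (\<exists>e f h. (e \<noteq> 0 \<or> f \<noteq> 0 \<or> h \<noteq> 0) \<and> e + (f + h) = 0 \<and>
      (\<exists>k. e * B x y + (f * B x y' + h * B x y'') = k \<and>
      e * B x' y + (f * B x' y' + h * B x' y'') = k \<and> e * B x'' y + (f * B x'' y' + h * B x'' y'') = k))"
    (is "(\<exists>e f h. ?L e f h) \<longleftrightarrow> (\<exists>e f h. ?R e f h)")
proof -
  have "(\<exists>c. (\<exists>q\<in>{y, y', y''}. c q \<noteq> 0) \<and> (\<forall>p\<in>{x, x', x''}. (\<Sum>q\<in>{y, y', y''}. c q * A p q) = 0)) \<longleftrightarrow>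
    (\<exists>c. (\<exists>q\<in>{y, y', y''}. c q \<noteq> 0) \<and> (\<Sum>q\<in>{y, y', y''}. c q) = 0 \<and>
      (\<exists>k. \<forall>p\<in>{x, x', x''}. (\<Sum>q\<in>{y, y', y''}. c q * B p q) = k))"
    by (rule compatibleD[OF comp]) (use assms in auto)
  then have "(\<exists>c. ?L (c y) (c y') (c y'')) \<longleftrightarrow> (\<exists>c. ?R (c y) (c y') (c y''))"
    using dist by simp
  then show ?thesis unfolding ex_fun_triple[OF dist, of ?L] ex_fun_triple[OF dist, of ?R] .
qed

text \<open>With three colours, a properly coloured rectangle repeats a colour on a diagonal, say
  \<open>a = d\<close>. If also \<open>b = c\<close>, the sums agree and the products do not;
  otherwise \<open>a\<close>, \<open>b\<close>, \<open>c\<close> are all the nonzero elements, so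
  \<open>a * a = b * c\<close> while \<open>b + c = a\<close> is not zero.\<close>

lemma compatible_same_pc4_free:
  fixes g :: "'a \<Rightarrow> 'b \<Rightarrow> gf4"
  assumes comp: "compatible X Y g g"
  shows "pc4_free X Y g"
  unfolding pc4_free_def
proof (intro ballI, rule ccontr)
  fix x x' y y' assume xy: "x \<in> X" "x' \<in> X" "y \<in> Y" "y' \<in> Y"
  assume n: "\<not> (g x y = g x y' \<or> g x' y = g x' y' \<or> g x y = g x' y \<or> g x y' = g x' y')"
  then have ne: "g x y \<noteq> g x y'" "g x' y \<noteq> g x' y'" "g x y \<noteq> g x' y" "g x y' \<noteq> g x' y'" and y: "y \<noteq> y'"
    by auto
  have nz: "g x y \<noteq> 0" "g x y' \<noteq> 0" "g x' y \<noteq> 0" "g x' y' \<noteq> 0"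
    using compatible_nonzero[OF comp] xy by auto
  have "\<forall>a b c d :: gf4. a \<noteq> 0 \<longrightarrow> b \<noteq> 0 \<longrightarrow> c \<noteq> 0 \<longrightarrow> d \<noteq> 0 \<longrightarrow> a \<noteq> b \<longrightarrow> c \<noteq> d \<longrightarrow> a \<noteq> c \<longrightarrow> b \<noteq> d \<longrightarrow>
    (a * d = b * c) \<noteq> (a - b = c - d)"
    by (simp add: gf4_eval)
  then show False using compatible_pair_det[OF comp xy y] nz ne by blast
qed

lemma compatible_same_hexagon_free:
  fixes g :: "'a \<Rightarrow> 'b \<Rightarrow> gf4"
  assumes comp: "compatible X Y g g"
  shows "hexagon_free X Y g"
  unfolding hexagon_free_def
proof (rule notI, elim bexE exE conjE)
  fix x x' x'' y y' y'' p q r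
  assume xy: "x \<in> X" "x' \<in> X" "x'' \<in> X" "y \<in> Y" "y' \<in> Y" "y'' \<in> Y"
    and ne: "p \<noteq> q" "q \<noteq> r" "p \<noteq> r"
    and g: "g x y = p" "g x y' = p" "g x y'' = q" "g x' y = r" "g x' y' = q" "g x' y'' = q"
      "g x'' y = r" "g x'' y' = p" "g x'' y'' = r"
  have dist: "y \<noteq> y'" "y' \<noteq> y''" "y \<noteq> y''" using g ne by auto
  have nz: "p \<noteq> 0" "q \<noteq> 0" "r \<noteq> 0" using compatible_nonzero[OF comp] xy g by metis+
  have facts: "\<forall>p q r :: gf4. p \<noteq> 0 \<longrightarrow> q \<noteq> 0 \<longrightarrow> r \<noteq> 0 \<longrightarrow> p \<noteq> q \<longrightarrow> q \<noteq> r \<longrightarrow> p \<noteq> r \<longrightarrow>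
    q * q + (r * r + p * p) = 0 \<and>
    q * q * r + (r * r * q + p * p * q) = q * q * p + (r * r * p + p * p * q) \<and>
    q * q * r + (r * r * p + p * p * r) = q * q * p + (r * r * p + p * p * q) \<and>
    (\<forall>e f h. e * p + (f * p + h * q) = 0 \<longrightarrow> e * r + (f * q + h * q) = 0 \<longrightarrow> e * r + (f * p + h * r) = 0 \<longrightarrow>
      e = 0 \<and> f = 0 \<and> h = 0)"
    by (simp add: gf4_eval)
  note f = facts[rule_format, OF nz ne]
  have "\<exists>e f h. (e \<noteq> 0 \<or> f \<noteq> 0 \<or> h \<noteq> 0) \<and> e + (f + h) = 0 \<and>
      (\<exists>k. e * p + (f * p + h * q) = k \<and> e * r + (f * q + h * q) = k \<and> e * r + (f * p + h * r) = k)"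
  proof (intro exI conjI)
    \<comment> \<open>If \<open>e + f + h = 0\<close>, then \<open>p + q + r = 0\<close> reduces the
      three row sums to \<open>h * r\<close>, \<open>e * p\<close> and \<open>f * q\<close>. The
      coefficients \<open>q * q\<close>, \<open>r * r\<close>, \<open>p * p\<close> make them
      equal.\<close>
    show "q * q \<noteq> 0 \<or> r * r \<noteq> 0 \<or> p * p \<noteq> 0" using nz by simp
    show "q * q + (r * r + p * p) = 0" using f by blast
    show "q * q * p + (r * r * p + p * p * q) = q * q * p + (r * r * p + p * p * q)" ..
    show "q * q * r + (r * r * q + p * p * q) = q * q * p + (r * r * p + p * p * q)" using f by blast
    show "q * q * r + (r * r * p + p * p * r) = q * q * p + (r * r * p + p * p * q)" using f by blast
  qed
  with compatible_triple[OF comp xy dist, unfolded g]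
  have "\<exists>e f h. (e \<noteq> 0 \<or> f \<noteq> 0 \<or> h \<noteq> 0) \<and> e * p + (f * p + h * q) = 0 \<and>
      e * r + (f * q + h * q) = 0 \<and> e * r + (f * p + h * r) = 0" by (rule iffD2)
  then show False using facts nz ne by metis
qed

section \<open>Finding a common rescaling\<close>

text \<open>Row ratios of \<open>A\<close> and row differences of \<open>B\<close> induce the same partition of the columns. If it has
  at most two classes, then some affine function maps ratios to differences; if it has three, this
  holds for exactly one of the two orders of the rows (Frobenius turns one into the other), and
  \<open>arrow\<close> records which.\<close>

definition affine_step :: "'e set \<Rightarrow> ('r \<Rightarrow> 'e \<Rightarrow> gf4) \<Rightarrow> ('r \<Rightarrow> 'e \<Rightarrow> gf4) \<Rightarrow> 'r \<Rightarrow> 'r \<Rightarrow> ('e \<Rightarrow> gf4) \<Rightarrow> bool" where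
  "affine_step Y A B x y \<alpha> \<longleftrightarrow> (\<exists>m k. m \<noteq> 0 \<and>
    (\<forall>q\<in>Y. A y q = \<alpha> q * m * A x q \<and> B y q = \<alpha> q + k + B x q))"

definition covers :: "'e set \<Rightarrow> ('e \<Rightarrow> gf4) \<Rightarrow> bool" where
  "covers Y \<alpha> \<longleftrightarrow> (\<forall>a. a \<noteq> 0 \<longrightarrow> (\<exists>q\<in>Y. \<alpha> q = a))"

definition arrow :: "'e set \<Rightarrow> ('r \<Rightarrow> 'e \<Rightarrow> gf4) \<Rightarrow> ('r \<Rightarrow> 'e \<Rightarrow> gf4) \<Rightarrow> 'r \<Rightarrow> 'r \<Rightarrow> bool" where
  "arrow Y A B x y \<longleftrightarrow> (\<exists>\<alpha>. affine_step Y A B x y \<alpha> \<and> covers Y \<alpha>)"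

section \<open>Labels along chains of affine steps\<close>

lemma affine_step_nonzero:
  assumes "compatible X Y A B" "y \<in> X" "q \<in> Y" "affine_step Y A B x y \<alpha>"
  shows "\<alpha> q \<noteq> 0"
  using assms(4) compatible_nonzero[OF assms(1-3)] assms(3) unfolding affine_step_def by auto

lemma coversE:
  assumes "covers Y \<alpha>" "a \<noteq> 0"
  obtains q where "q \<in> Y" "\<alpha> q = a"
  using assms unfolding covers_def by blast

text \<open>Relative to row \<open>r 0\<close>, ratios multiply and differences add along the chain;
  a gauge removes that row and the constants. Statements about chains thus compare products with
  sums of labels.\<close>

lemma chain_compatible:
  assumes comp: "compatible X Y A B"
    and r: "\<And>i. i \<le> n \<Longrightarrow> r i \<in> X"
    and step: "\<And>i. i < n \<Longrightarrow> affine_step Y A B (r i) (r (Suc i)) (\<alpha> i)"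
  shows "compatible {..n} Y (\<lambda>i q. \<Prod>j<i. \<alpha> j q) (\<lambda>i q. \<Sum>j<i. \<alpha> j q)"
proof -
  have "\<exists>u k. u \<noteq> 0 \<and> (\<forall>q\<in>Y. A (r i) q = (\<Prod>j<i. \<alpha> j q) * u * A (r 0) q \<and>
      B (r i) q = (\<Sum>j<i. \<alpha> j q) + k + B (r 0) q)" if "i \<le> n" for i
    using that
  proof (induction i)
    case 0
    then show ?case by (intro exI[of _ 1] exI[of _ 0]) simp
  next
    case (Suc i)
    then obtain u k where u: "u \<noteq> 0" "\<forall>q\<in>Y. A (r i) q = (\<Prod>j<i. \<alpha> j q) * u * A (r 0) q \<and>
      B (r i) q = (\<Sum>j<i. \<alpha> j q) + k + B (r 0) q" by auto
    obtain m l where m: "m \<noteq> 0" "\<forall>q\<in>Y. A (r (Suc i)) q = \<alpha> i q * m * A (r i) q \<and>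
      B (r (Suc i)) q = \<alpha> i q + l + B (r i) q"
      using step[of i] Suc.prems unfolding affine_step_def by auto
    have "A (r (Suc i)) q = (\<Prod>j<Suc i. \<alpha> j q) * (m * u) * A (r 0) q"
      "B (r (Suc i)) q = (\<Sum>j<Suc i. \<alpha> j q) + (l + k) + B (r 0) q" if "q \<in> Y" for q
    proof -
      have "A (r (Suc i)) q = \<alpha> i q * m * ((\<Prod>j<i. \<alpha> j q) * u * A (r 0) q)"
        "B (r (Suc i)) q = \<alpha> i q + l + ((\<Sum>j<i. \<alpha> j q) + k + B (r 0) q)"
        using u(2) m(2) that by metis+
      then show "A (r (Suc i)) q = (\<Prod>j<Suc i. \<alpha> j q) * (m * u) * A (r 0) q"
        "B (r (Suc i)) q = (\<Sum>j<Suc i. \<alpha> j q) + (l + k) + B (r 0) q"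
        by (simp_all only: prod.lessThan_Suc sum.lessThan_Suc mult_ac add_ac)
    qed
    then show ?case using u(1) m(1) by (intro exI[of _ "m * u"] exI[of _ "l + k"]) auto
  qed
  then obtain u k where u: "\<And>i. i \<le> n \<Longrightarrow> u i \<noteq> 0"
    "\<And>i q. i \<le> n \<Longrightarrow> q \<in> Y \<Longrightarrow> A (r i) q = (\<Prod>j<i. \<alpha> j q) * u i * A (r 0) q"
    "\<And>i q. i \<le> n \<Longrightarrow> q \<in> Y \<Longrightarrow> B (r i) q = (\<Sum>j<i. \<alpha> j q) + k i + B (r 0) q" by metis
  have "compatible {..n} Y (\<lambda>i. A (r i)) (\<lambda>i. B (r i))"
    using r by (intro compatible_reindex[OF comp]) auto
  then show ?thesis
  proof (rule compatible_gauge[where r = u and s = "A (r 0)" and k = k and l = "B (r 0)"])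
    fix i q assume "i \<in> {..n}" "q \<in> Y"
    then show "A (r i) q = (\<Prod>j<i. \<alpha> j q) * u i * A (r 0) q"
      "B (r i) q = (\<Sum>j<i. \<alpha> j q) + k i + B (r 0) q"
      by (blast intro: u(2,3))+
  next
    fix i assume "i \<in> {..n}"
    then show "u i \<noteq> 0" using u(1) by blast
  next
    fix q assume "q \<in> Y"
    then show "A (r 0) q \<noteq> 0" using compatible_nonzero[OF comp r] by blast
  qed
qed

lemma chain2_compatible:
  assumes comp: "compatible X Y A B" and "x \<in> X" "y \<in> X" "z \<in> X"
    and "affine_step Y A B x y \<alpha>" "affine_step Y A B y z \<beta>"
  shows "compatible {..2::nat} Y (\<lambda>i q. [1, \<alpha> q, \<alpha> q * \<beta> q] ! i) (\<lambda>i q. [0, \<alpha> q, \<alpha> q + \<beta> q] ! i)"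
proof -
  have "compatible {..2::nat} Y (\<lambda>i q. \<Prod>j<i. ([\<alpha>, \<beta>] ! j) q) (\<lambda>i q. \<Sum>j<i. ([\<alpha>, \<beta>] ! j) q)"
    by (rule chain_compatible[OF comp, of 2 "\<lambda>i. [x, y, z] ! i"])
      (use assms in \<open>auto simp: le_Suc_eq less_Suc_eq numeral_2_eq_2\<close>)
  then show ?thesis
    \<comment> \<open>The trivial gauge acts as a congruence rule, since compatibility only sees
      entries on the index sets.\<close>
    by (rule compatible_gauge[where r = "\<lambda>_. 1" and s = "\<lambda>_. 1" and k = "\<lambda>_. 0" and l = "\<lambda>_. 0"])
      (auto simp: le_Suc_eq numeral_2_eq_2 lessThan_Suc mult.commute add.commute)
qed

lemma chain3_compatible:
  assumes comp: "compatible X Y A B" and "x \<in> X" "y \<in> X" "z \<in> X" "t \<in> X"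
    and "affine_step Y A B x y \<alpha>" "affine_step Y A B y z \<beta>" "affine_step Y A B z t \<gamma>"
  shows "compatible {..3::nat} Y (\<lambda>i q. [1, \<alpha> q, \<alpha> q * \<beta> q, \<alpha> q * \<beta> q * \<gamma> q] ! i)
    (\<lambda>i q. [0, \<alpha> q, \<alpha> q + \<beta> q, \<alpha> q + \<beta> q + \<gamma> q] ! i)"
proof -
  have "compatible {..3::nat} Y (\<lambda>i q. \<Prod>j<i. ([\<alpha>, \<beta>, \<gamma>] ! j) q) (\<lambda>i q. \<Sum>j<i. ([\<alpha>, \<beta>, \<gamma>] ! j) q)"
    by (rule chain_compatible[OF comp, of 3 "\<lambda>i. [x, y, z, t] ! i"])
      (use assms in \<open>auto simp: le_Suc_eq less_Suc_eq numeral_3_eq_3\<close>)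
  then show ?thesis
    by (rule compatible_gauge[where r = "\<lambda>_. 1" and s = "\<lambda>_. 1" and k = "\<lambda>_. 0" and l = "\<lambda>_. 0"])
      (auto simp: le_Suc_eq numeral_3_eq_3 lessThan_Suc mult_ac add_ac)
qed

text \<open>The nonzero elements sum to zero, so the third one is \<open>a + b\<close>.\<close>

lemma gf4_obtain_third:
  fixes a b :: gf4
  assumes "a \<noteq> 0" "b \<noteq> 0" "a \<noteq> b"
  obtains c where "c \<noteq> 0" "a \<noteq> c" "b \<noteq> c" "\<And>x. x \<noteq> 0 \<Longrightarrow> x = a \<or> x = b \<or> x = c"
proof -
  have "\<forall>a b :: gf4. a \<noteq> 0 \<longrightarrow> b \<noteq> 0 \<longrightarrow> a \<noteq> b \<longrightarrow> a + b \<noteq> 0 \<and> a \<noteq> a + b \<and> b \<noteq> a + b"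
    by (simp add: gf4_eval)
  then have c: "a + b \<noteq> 0" "a \<noteq> a + b" "b \<noteq> a + b" using assms by blast+
  then show thesis using that[of "a + b"] gf4_three_values[of a b "a + b"] assms by blast
qed

text \<open>The pairs of labels lie on a cross with centre \<open>\<rho>\<close>. A pair with equal
  entries is the centre by minors of order two; if there is none, a minor of order three excludes
  cyclic triples of pairs.\<close>

lemma chain_cross:
  assumes comp: "compatible X Y A B" and X: "x \<in> X" "y \<in> X" "z \<in> X"
    and st: "affine_step Y A B x y \<alpha>" "affine_step Y A B y z \<beta>"
    and cov: "covers Y \<alpha>" "covers Y \<beta>"
  obtains \<rho> where "\<rho> \<noteq> 0" "\<And>q. q \<in> Y \<Longrightarrow> \<alpha> q = \<rho> \<or> \<beta> q = \<rho>"
proof -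
  note found = that
  note ch = chain2_compatible[OF comp X st]
  have nz: "\<alpha> q \<noteq> 0" "\<beta> q \<noteq> 0" if "q \<in> Y" for q
    using affine_step_nonzero[OF comp _ that] X st by auto
  have pair: "\<alpha> q * \<beta> q = \<alpha> q' * \<beta> q' \<longleftrightarrow> \<alpha> q + \<beta> q = \<alpha> q' + \<beta> q'" if "q \<in> Y" "q' \<in> Y" for q q'
  proof (cases "q = q'")
    case False
    then show ?thesis using compatible_pair_det[OF ch, of 0 2 q q'] that by (auto simp: numeral_2_eq_2)
  qed simp
  show thesis
  proof (cases "\<exists>q\<in>Y. \<alpha> q = \<beta> q")
    case True
    then obtain q a where q: "q \<in> Y" "\<alpha> q = a" "\<beta> q = a" by metis
    \<comment> \<open>For \<open>b\<close> and \<open>c\<close> different from \<open>a\<close>, the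
      products agree exactly if \<open>b\<close> and \<open>c\<close> differ, the sums exactly if
      they are equal.\<close>
    have fact: "\<forall>a b c :: gf4. a \<noteq> 0 \<longrightarrow> b \<noteq> 0 \<longrightarrow> c \<noteq> 0 \<longrightarrow> b \<noteq> a \<longrightarrow> c \<noteq> a \<longrightarrow> (a * a = b * c) \<noteq> (a + a = b + c)"
      by (simp add: gf4_eval)
    have "\<alpha> q' = a \<or> \<beta> q' = a" if "q' \<in> Y" for q'
      using fact[rule_format, of a "\<alpha> q'" "\<beta> q'"] pair[OF q(1) that] nz[OF that] nz[OF q(1)] q(2,3) by auto
    then show thesis using that[of a] nz(1)[OF q(1)] q(2) by blast
  next
    case False
    \<comment> \<open>The sums are annihilated by the coefficients \<open>a\<close>,
      \<open>b\<close>, \<open>c\<close>, because \<open>a + b + c\<close> and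
      \<open>a * b + b * c + c * a\<close> vanish for the three nonzero elements. The products form
      a nonsingular matrix.\<close>
    have no_cycle: False if q: "q1 \<in> Y" "q2 \<in> Y" "q3 \<in> Y" and abc: "a \<noteq> b" "b \<noteq> c" "a \<noteq> c"
      and v: "\<alpha> q1 = a" "\<beta> q1 = b" "\<alpha> q2 = b" "\<beta> q2 = c" "\<alpha> q3 = c" "\<beta> q3 = a" for q1 q2 q3 a b c
    proof -
      have abc0: "a \<noteq> 0" "b \<noteq> 0" "c \<noteq> 0" using nz q v by metis+
      have dist: "q1 \<noteq> q2" "q2 \<noteq> q3" "q1 \<noteq> q3" using v abc by auto
      have facts: "\<forall>a b c :: gf4. a \<noteq> 0 \<longrightarrow> b \<noteq> 0 \<longrightarrow> c \<noteq> 0 \<longrightarrow> a \<noteq> b \<longrightarrow> b \<noteq> c \<longrightarrow> a \<noteq> c \<longrightarrow>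
        a + (b + c) = 0 \<and> a * a + (b * b + c * c) = 0 \<and> a * (a + b) + (b * (b + c) + c * (c + a)) = 0 \<and>
        (\<forall>e f h. e + (f + h) = 0 \<longrightarrow> e * a + (f * b + h * c) = 0 \<longrightarrow> e * (a * b) + (f * (b * c) + h * (c * a)) = 0 \<longrightarrow>
          e = 0 \<and> f = 0 \<and> h = 0)"
        by (simp add: gf4_eval)
      note f = facts[rule_format, OF abc0 abc]
      have "\<exists>e f h. (e \<noteq> 0 \<or> f \<noteq> 0 \<or> h \<noteq> 0) \<and> e + (f + h) = 0 \<and>
        (\<exists>k. e * 0 + (f * 0 + h * 0) = k \<and> e * a + (f * b + h * c) = k \<and>
          e * (a + b) + (f * (b + c) + h * (c + a)) = k)"
        using conjunct1[OF f] conjunct1[OF conjunct2[OF f]] conjunct1[OF conjunct2[OF conjunct2[OF f]]] abc0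
        by (intro exI[of _ a] exI[of _ b] exI[of _ c] exI[of _ 0]) simp
      with compatible_triple[OF ch, of 0 1 2 q1 q2 q3] q dist
      have "\<exists>e f h. (e \<noteq> 0 \<or> f \<noteq> 0 \<or> h \<noteq> 0) \<and> e * 1 + (f * 1 + h * 1) = 0 \<and> e * a + (f * b + h * c) = 0 \<and>
        e * (a * b) + (f * (b * c) + h * (c * a)) = 0"
        using v by (simp add: numeral_2_eq_2)
      then show False using conjunct2[OF conjunct2[OF conjunct2[OF f]]] by (metis mult.right_neutral)
    qed
    \<comment> \<open>If \<open>(u, v)\<close> is missing, covering forces the pairs
      \<open>(u, w)\<close> and \<open>(w, v)\<close>; these exclude \<open>(v, u)\<close>, and
      every other pair contains \<open>w\<close>.\<close>
    have center: thesis if uv: "u \<noteq> 0" "v \<noteq> 0" "u \<noteq> v" and miss: "\<And>q. q \<in> Y \<Longrightarrow> \<not> (\<alpha> q = u \<and> \<beta> q = v)" for u v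
    proof -
      obtain w where w: "w \<noteq> 0" "u \<noteq> w" "v \<noteq> w" "\<And>x. x \<noteq> 0 \<Longrightarrow> x = u \<or> x = v \<or> x = w"
        using gf4_obtain_third[OF uv] by blast
      obtain q1 where q1: "q1 \<in> Y" "\<alpha> q1 = u" using coversE[OF cov(1) uv(1)] by blast
      have b1: "\<beta> q1 = w" using w(4)[OF nz(2)[OF q1(1)]] q1 miss False by metis
      obtain q2 where q2: "q2 \<in> Y" "\<beta> q2 = v" using coversE[OF cov(2) uv(2)] by blast
      have a2: "\<alpha> q2 = w" using w(4)[OF nz(1)[OF q2(1)]] q2 miss False by metis
      have "\<alpha> q = w \<or> \<beta> q = w" if q: "q \<in> Y" for q
      proof (rule ccontr)
        assume n: "\<not> ?thesis"
        then have "\<alpha> q = v" "\<beta> q = u"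
          using w(4)[OF nz(1)[OF q]] w(4)[OF nz(2)[OF q]] miss[OF q] False q by metis+
        then show False using no_cycle[of q1 q2 q u w v] q1 q2 q b1 a2 uv w by metis
      qed
      then show thesis using found w(1) by blast
    qed
    obtain q1 where q1: "q1 \<in> Y" "\<alpha> q1 = 1" using coversE[OF cov(1), of 1] by auto
    define a b where ab: "a = \<alpha> q1" "b = \<beta> q1"
    have ab0: "a \<noteq> 0" "b \<noteq> 0" "a \<noteq> b" using nz q1 False ab by auto
    obtain c where c: "c \<noteq> 0" "a \<noteq> c" "b \<noteq> c" using gf4_obtain_third[OF ab0] by blast
    show thesis
    \<comment> \<open>At least one of \<open>(b, c)\<close> and \<open>(c, a)\<close> is missing,
      since both would close a cycle with \<open>(a, b)\<close>.\<close>
    proof (cases "\<exists>q2\<in>Y. \<alpha> q2 = b \<and> \<beta> q2 = c")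
      case True
      then obtain q2 where "q2 \<in> Y" "\<alpha> q2 = b" "\<beta> q2 = c" by blast
      then have "\<And>q. q \<in> Y \<Longrightarrow> \<not> (\<alpha> q = c \<and> \<beta> q = a)"
        using no_cycle[of q1 q2 _ a b c] q1(1) ab ab0 c by metis
      then show thesis using center[of c a] c ab0 by metis
    next
      case False
      then show thesis using center[of b c] c ab0 by blast
    qed
  qed
qed

text \<open>Crosses with a common centre are transitive; this supplies the column where both labels
  are central in \<open>arrow_shortcut\<close>.\<close>

lemma chain_same_center:
  assumes comp: "compatible X Y A B" and X: "x \<in> X" "y \<in> X" "z \<in> X" "t \<in> X"
    and st: "affine_step Y A B x y \<alpha>" "affine_step Y A B y z \<beta>" "affine_step Y A B z t \<gamma>"
    and cov: "covers Y \<alpha>" "covers Y \<beta>"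
    and \<rho>: "\<rho> \<noteq> 0" "\<And>q. q \<in> Y \<Longrightarrow> \<alpha> q = \<rho> \<or> \<beta> q = \<rho>" "\<And>q. q \<in> Y \<Longrightarrow> \<beta> q = \<rho> \<or> \<gamma> q = \<rho>"
    and q: "q \<in> Y"
  shows "\<alpha> q = \<rho> \<or> \<gamma> q = \<rho>"
proof -
  note ch = chain3_compatible[OF comp X st]
  have nz: "\<alpha> q \<noteq> 0" "\<beta> q \<noteq> 0" "\<gamma> q \<noteq> 0" if "q \<in> Y" for q
    using affine_step_nonzero[OF comp _ that] X st by auto
  have pair: "\<alpha> q * \<beta> q * \<gamma> q = \<alpha> q' * \<beta> q' * \<gamma> q' \<longleftrightarrow> \<alpha> q + \<beta> q + \<gamma> q = \<alpha> q' + \<beta> q' + \<gamma> q'"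
    if "q \<in> Y" "q' \<in> Y" for q q'
  proof (cases "q = q'")
    case False
    then show ?thesis using compatible_pair_det[OF ch, of 0 3 q q'] that by (auto simp: numeral_3_eq_3)
  qed simp
  \<comment> \<open>Labels \<open>(a, \<rho>, a)\<close> and \<open>(\<rho>, c, \<rho>)\<close> have
    equal products but different sums when \<open>a\<close>, \<open>\<rho>\<close>, \<open>c\<close>
    are distinct.\<close>
  have distinct_ends: "\<alpha> q \<noteq> \<gamma> q" if q: "q \<in> Y" "\<alpha> q \<noteq> \<rho>" for q
  proof
    assume eq: "\<alpha> q = \<gamma> q"
    have b: "\<beta> q = \<rho>" using \<rho>(2)[OF q(1)] q(2) by blast
    obtain c where c: "c \<noteq> 0" "\<rho> \<noteq> c" "\<alpha> q \<noteq> c" using gf4_obtain_third[OF \<rho>(1) nz(1)[OF q(1)]] q(2) by metis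
    obtain w where w: "w \<in> Y" "\<beta> w = c" using coversE[OF cov(2) c(1)] by blast
    have "\<alpha> w = \<rho>" "\<gamma> w = \<rho>" using \<rho>(2,3)[OF w(1)] w(2) c(2) by auto
    then have "\<alpha> q * \<rho> * \<alpha> q = \<rho> * c * \<rho> \<longleftrightarrow> \<alpha> q + \<rho> + \<alpha> q = \<rho> + c + \<rho>"
      using pair[OF q(1) w(1)] b eq w by simp
    moreover have "\<forall>a r c :: gf4. a \<noteq> 0 \<longrightarrow> r \<noteq> 0 \<longrightarrow> c \<noteq> 0 \<longrightarrow> r \<noteq> c \<longrightarrow> a \<noteq> c \<longrightarrow> a \<noteq> r \<longrightarrow>
      (a * r * a = r * c * r) \<noteq> (a + r + a = r + c + r)"
      by (simp add: gf4_eval)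
    ultimately show False using nz(1)[OF q(1)] \<rho>(1) c q(2) by metis
  qed
  show ?thesis
  proof (rule ccontr)
    assume neg: "\<not> ?thesis"
    \<comment> \<open>The label triples will be \<open>(a, \<rho>, b)\<close> at \<open>q\<close>,
      \<open>(\<rho>, a, \<rho>)\<close> at \<open>u\<close>, \<open>(\<rho>, b, \<rho>)\<close> at
      \<open>v\<close>, and \<open>b\<close>, \<open>\<rho>\<close> followed by
      \<open>\<rho>\<close> or \<open>a\<close> at \<open>w\<close>.\<close>
    define a b where ab: "a = \<alpha> q" "b = \<gamma> q"
    have bq: "\<beta> q = \<rho>" using \<rho>(2)[OF q] neg by blast
    have ne: "a \<noteq> \<rho>" "b \<noteq> \<rho>" "a \<noteq> b" using neg distinct_ends[OF q] ab by auto
    have abnz: "a \<noteq> 0" "b \<noteq> 0" using nz[OF q] ab by auto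
    obtain w where w: "w \<in> Y" "\<alpha> w = b" using coversE[OF cov(1) abnz(2)] by blast
    have bw: "\<beta> w = \<rho>" using \<rho>(2)[OF w(1)] w(2) ne by auto
    obtain u where u: "u \<in> Y" "\<beta> u = a" using coversE[OF cov(2) abnz(1)] by blast
    have uv: "\<alpha> u = \<rho>" "\<gamma> u = \<rho>" using \<rho>(2,3)[OF u(1)] u(2) ne by auto
    obtain v where v: "v \<in> Y" "\<beta> v = b" using coversE[OF cov(2) abnz(2)] by blast
    have vv: "\<alpha> v = \<rho>" "\<gamma> v = \<rho>" using \<rho>(2,3)[OF v(1)] v(2) ne by auto
    have dist: "u \<noteq> q" "q \<noteq> w" "u \<noteq> w" "u \<noteq> v" "v \<noteq> q" "v \<noteq> w" using u v w bq bw ab ne by auto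
    have "\<gamma> w \<noteq> b" using distinct_ends[OF w(1)] w ne by auto
    then consider "\<gamma> w = \<rho>" | "\<gamma> w = a"
      using gf4_three_values[OF abnz \<rho>(1) ne(3) ne(2) ne(1) nz(3)[OF w(1)]] by blast
    then show False
    proof cases
      case 1
      have facts: "\<forall>a b r :: gf4. a \<noteq> 0 \<longrightarrow> b \<noteq> 0 \<longrightarrow> r \<noteq> 0 \<longrightarrow> a \<noteq> r \<longrightarrow> b \<noteq> r \<longrightarrow> a \<noteq> b \<longrightarrow>
        r + (a + b) = 0 \<and> r * r + (a * a + b * b) = 0 \<and>
        r * (r + a + r) + (a * (a + r + b) + b * (b + r + r)) = 0 \<and>
        (\<forall>e f h. e + (f + h) = 0 \<longrightarrow> e * r + (f * a + h * b) = 0 \<longrightarrow>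
          e * (r * a * r) + (f * (a * r * b) + h * (b * r * r)) = 0 \<longrightarrow> e = 0 \<and> f = 0 \<and> h = 0)"
        by (simp add: gf4_eval)
      note f = facts[rule_format, OF abnz \<rho>(1) ne]
      have "\<exists>e f h. (e \<noteq> 0 \<or> f \<noteq> 0 \<or> h \<noteq> 0) \<and> e + (f + h) = 0 \<and>
        (\<exists>k. e * 0 + (f * 0 + h * 0) = k \<and> e * \<rho> + (f * a + h * b) = k \<and>
          e * (\<rho> + a + \<rho>) + (f * (a + \<rho> + b) + h * (b + \<rho> + \<rho>)) = k)"
        using conjunct1[OF f] conjunct1[OF conjunct2[OF f]] conjunct1[OF conjunct2[OF conjunct2[OF f]]] \<rho>(1)
        by (intro exI[of _ \<rho>] exI[of _ a] exI[of _ b] exI[of _ 0]) simp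
      with compatible_triple[OF ch, of 0 1 3 u q w] u q w dist
      have "\<exists>e f h. (e \<noteq> 0 \<or> f \<noteq> 0 \<or> h \<noteq> 0) \<and> e * 1 + (f * 1 + h * 1) = 0 \<and> e * \<rho> + (f * a + h * b) = 0 \<and>
        e * (\<rho> * a * \<rho>) + (f * (a * \<rho> * b) + h * (b * \<rho> * \<rho>)) = 0"
        using uv bq bw 1 ab by (simp add: numeral_3_eq_3)
      then show False using conjunct2[OF conjunct2[OF conjunct2[OF f]]] by (metis mult.right_neutral)
    next
      case 2
      \<comment> \<open>Now a minor of order four decides: the products have the kernel vector
        \<open>(a, b, a, b)\<close> on \<open>u\<close>, \<open>v\<close>, \<open>q\<close>,
        \<open>w\<close>, whereas the sums admit no nontrivial coefficients with total zero.\<close>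
      have facts: "\<forall>a b r :: gf4. a \<noteq> 0 \<longrightarrow> b \<noteq> 0 \<longrightarrow> r \<noteq> 0 \<longrightarrow> a \<noteq> r \<longrightarrow> b \<noteq> r \<longrightarrow> a \<noteq> b \<longrightarrow>
        a + (b + (a + b)) = 0 \<and> a * r + (b * r + (a * a + b * b)) = 0 \<and>
        a * (r * a) + (b * (r * b) + (a * (a * r) + b * (b * r))) = 0 \<and>
        a * (r * a * r) + (b * (r * b * r) + (a * (a * r * b) + b * (b * r * a))) = 0"
        by (simp add: gf4_eval)
      \<comment> \<open>Replacing \<open>\<rho>\<close> by \<open>a + b\<close> and eliminating the
        coefficient at \<open>w\<close> leaves five field variables to enumerate.\<close>
      have facts': "\<forall>a b e f h :: gf4. a \<noteq> 0 \<longrightarrow> b \<noteq> 0 \<longrightarrow> a \<noteq> b \<longrightarrow>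
        e * (a + b) + (f * (a + b) + (h * a + (e + (f + h)) * b)) = 0 \<longrightarrow>
        e * (a + b + a) + (f * (a + b + b) + (h * (a + (a + b)) + (e + (f + h)) * (b + (a + b)))) = 0 \<longrightarrow>
        e * (a + b + a + (a + b)) + (f * (a + b + b + (a + b)) +
          (h * (a + (a + b) + b) + (e + (f + h)) * (b + (a + b) + a))) = 0 \<longrightarrow>
        e = 0 \<and> f = 0 \<and> h = 0"
        by (simp add: gf4_eval)
      have "\<forall>a b r :: gf4. a \<noteq> 0 \<longrightarrow> b \<noteq> 0 \<longrightarrow> r \<noteq> 0 \<longrightarrow> a \<noteq> r \<longrightarrow> b \<noteq> r \<longrightarrow> a \<noteq> b \<longrightarrow> r = a + b"
        by (simp add: gf4_eval)
      then have r: "\<rho> = a + b" using abnz \<rho>(1) ne by blast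
      note f = facts[rule_format, OF abnz \<rho>(1) ne]
      define c where "c s = (if s = u \<or> s = q then a else b)" for s
      have val: "(\<Sum>s\<in>{u, v, q, w}. c s * F s) = a * F u + (b * F v + (a * F q + b * F w))" for F
        using dist by (simp add: c_def)
      have "(\<Sum>s\<in>{u, v, q, w}. c s * 1) = 0"
        using conjunct1[OF f] val[of "\<lambda>_. 1"] by (simp only: mult_1_right)
      moreover have "(\<Sum>s\<in>{u, v, q, w}. c s * \<alpha> s) = 0"
        unfolding val uv vv w(2) ab[symmetric] by (rule conjunct1[OF conjunct2[OF f]])
      moreover have "(\<Sum>s\<in>{u, v, q, w}. c s * (\<alpha> s * \<beta> s)) = 0"
        unfolding val uv vv w(2) u(2) v(2) bq bw ab[symmetric]
        by (rule conjunct1[OF conjunct2[OF conjunct2[OF f]]])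
      moreover have "(\<Sum>s\<in>{u, v, q, w}. c s * (\<alpha> s * \<beta> s * \<gamma> s)) = 0"
        unfolding val uv vv w(2) u(2) v(2) bq bw 2 ab[symmetric]
        by (rule conjunct2[OF conjunct2[OF conjunct2[OF f]]])
      moreover have "\<exists>s\<in>{u, v, q, w}. c s \<noteq> 0" using abnz by (auto simp: c_def)
      ultimately have "(\<exists>s\<in>{u, v, q, w}. c s \<noteq> 0) \<and> (\<forall>i\<in>{..3::nat}. (\<Sum>s\<in>{u, v, q, w}. c s *
          ([1, \<alpha> s, \<alpha> s * \<beta> s, \<alpha> s * \<beta> s * \<gamma> s] ! i)) = 0)"
        unfolding numeral_3_eq_3 atMost_Suc atMost_0
        by (simp only: ball_simps nth_Cons_0 nth_Cons_Suc simp_thms)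
      then have "\<exists>c. (\<exists>s\<in>{u, v, q, w}. c s \<noteq> 0) \<and> (\<Sum>s\<in>{u, v, q, w}. c s) = 0 \<and>
          (\<exists>k. \<forall>i\<in>{..3::nat}. (\<Sum>s\<in>{u, v, q, w}. c s * ([0, \<alpha> s, \<alpha> s + \<beta> s, \<alpha> s + \<beta> s + \<gamma> s] ! i)) = k)"
        using u(1) v(1) q w(1) by (intro iffD1[OF compatibleD[OF ch]] exI[of _ c]) auto
      then obtain c' k where c': "\<exists>s\<in>{u, v, q, w}. c' s \<noteq> 0" "(\<Sum>s\<in>{u, v, q, w}. c' s) = 0"
        and sums: "\<forall>i\<in>{..3::nat}. (\<Sum>s\<in>{u, v, q, w}. c' s * ([0, \<alpha> s, \<alpha> s + \<beta> s, \<alpha> s + \<beta> s + \<gamma> s] ! i)) = k"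
        by (elim exE conjE)
      have c'3: "(\<Sum>s\<in>{u, v, q, w}. c' s * ([0, \<alpha> s, \<alpha> s + \<beta> s, \<alpha> s + \<beta> s + \<gamma> s] ! i)) = k" if "i \<le> 3" for i
        using bspec[OF sums] that by blast
      have k: "k = 0" using c'3[of 0] by simp
      have "c' u + (c' v + c' q) + c' w = 0" using c'(2) dist by (simp add: add.assoc)
      then have cw: "c' w = c' u + (c' v + c' q)" by (simp add: gf4_add_eq_0_iff)
      have "c' u * \<rho> + (c' v * \<rho> + (c' q * a + c' w * b)) = 0"
        using c'3[of 1] dist k uv vv w ab by simp
      moreover have "c' u * (\<rho> + a) + (c' v * (\<rho> + b) + (c' q * (a + \<rho>) + c' w * (b + \<rho>))) = 0"
        using c'3[of 2] dist k u v uv vv w ab bq bw by simp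
      moreover have "c' u * (\<rho> + a + \<rho>) + (c' v * (\<rho> + b + \<rho>) + (c' q * (a + \<rho> + b) + c' w * (b + \<rho> + a))) = 0"
        using c'3[of 3] dist k u v uv vv w ab bq bw 2 by simp
      ultimately have "c' u = 0 \<and> c' v = 0 \<and> c' q = 0"
        using facts' abnz ne(3) unfolding r cw by blast
      then show False using c'(1) cw by auto
    qed
  qed
qed

text \<open>On a cross one label is \<open>\<rho>\<close>, so
  \<open>\<alpha> q * \<beta> q / \<rho>\<close> is the other one, and the same function describes
  both the product up to a factor and the sum up to a constant.\<close>

lemma arrow_shortcut:
  assumes comp: "compatible X Y A B" and X: "x \<in> X" "y \<in> X" "z \<in> X" "t \<in> X"
    and st: "affine_step Y A B x y \<alpha>" "affine_step Y A B y z \<beta>" "affine_step Y A B z t \<gamma>"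
    and cov: "covers Y \<alpha>" "covers Y \<beta>" "covers Y \<gamma>"
    and \<rho>: "\<rho> \<noteq> 0" "\<And>q. q \<in> Y \<Longrightarrow> \<alpha> q = \<rho> \<or> \<beta> q = \<rho>" "\<And>q. q \<in> Y \<Longrightarrow> \<beta> q = \<rho> \<or> \<gamma> q = \<rho>"
  shows "arrow Y A B x z"
proof -
  define \<delta> where "\<delta> q = \<alpha> q * \<beta> q / \<rho>" for q
  have sum: "\<alpha> q + \<beta> q = \<delta> q + \<rho>" if "q \<in> Y" for q
    using \<rho>(1) \<rho>(2)[OF that] by (auto simp: \<delta>_def add.commute)
  obtain m k where m: "m \<noteq> 0" "\<And>q. q \<in> Y \<Longrightarrow> A y q = \<alpha> q * m * A x q" "\<And>q. q \<in> Y \<Longrightarrow> B y q = \<alpha> q + k + B x q"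
    using st(1) unfolding affine_step_def by auto
  obtain n l where n: "n \<noteq> 0" "\<And>q. q \<in> Y \<Longrightarrow> A z q = \<beta> q * n * A y q" "\<And>q. q \<in> Y \<Longrightarrow> B z q = \<beta> q + l + B y q"
    using st(2) unfolding affine_step_def by auto
  have "A z q = \<delta> q * (\<rho> * m * n) * A x q \<and> B z q = \<delta> q + (\<rho> + k + l) + B x q" if q: "q \<in> Y" for q
  proof
    show "A z q = \<delta> q * (\<rho> * m * n) * A x q"
      using \<rho>(1) by (simp add: n(2)[OF q] m(2)[OF q] \<delta>_def)
    have "B z q = \<alpha> q + \<beta> q + k + l + B x q" by (simp add: n(3)[OF q] m(3)[OF q] add_ac)
    then show "B z q = \<delta> q + (\<rho> + k + l) + B x q" unfolding sum[OF q] by (simp add: add_ac)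
  qed
  then have "affine_step Y A B x z \<delta>"
    using \<rho>(1) m(1) n(1) unfolding affine_step_def by (intro exI[of _ "\<rho> * m * n"] exI[of _ "\<rho> + k + l"]) auto
  moreover have "covers Y \<delta>"
    unfolding covers_def
  proof (intro allI impI)
    fix a :: gf4 assume a: "a \<noteq> 0"
    show "\<exists>q\<in>Y. \<delta> q = a"
    proof (cases "a = \<rho>")
      case True
      \<comment> \<open>The value \<open>\<rho>\<close> requires both labels to be central. A column
        with \<open>\<gamma> q \<noteq> \<rho>\<close> achieves this, which is the purpose of the
        third arrow.\<close>
      have "\<forall>r :: gf4. \<exists>b. b \<noteq> 0 \<and> b \<noteq> r" by (simp add: gf4_eval)
      then obtain b where b: "b \<noteq> 0" "b \<noteq> \<rho>" by blast
      obtain q where q: "q \<in> Y" "\<gamma> q = b" using coversE[OF cov(3) b(1)] by blast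
      then have "\<beta> q = \<rho>" using \<rho>(3) b by auto
      moreover have "\<alpha> q = \<rho>"
        using chain_same_center[OF comp X st cov(1,2) \<rho> q(1)] q b by auto
      ultimately show ?thesis using q True \<rho>(1) by (intro bexI[of _ q]) (auto simp: \<delta>_def)
    next
      case False
      obtain q where q: "q \<in> Y" "\<beta> q = a" using coversE[OF cov(2) a] by blast
      then have "\<alpha> q = \<rho>" using \<rho>(2) False by auto
      then show ?thesis using q \<rho>(1) by (intro bexI[of _ q]) (auto simp: \<delta>_def)
    qed
  qed
  ultimately show ?thesis unfolding arrow_def by blast
qed

section \<open>Acyclicity of the arrows\<close>

lemma not_arrow_self:
  assumes comp: "compatible X Y A B" and x: "x \<in> X"
  shows "\<not> arrow Y A B x x"
proof
  assume "arrow Y A B x x"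
  then obtain \<alpha> m where c: "covers Y \<alpha>" and m: "m \<noteq> 0" "\<And>q. q \<in> Y \<Longrightarrow> A x q = \<alpha> q * m * A x q"
    unfolding arrow_def affine_step_def by blast
  have const: "\<alpha> q = inverse m" if "q \<in> Y" for q
    using m(2)[OF that] m(1) compatible_nonzero[OF comp x that] by (auto simp: field_simps)
  have "\<forall>r :: gf4. \<exists>b. b \<noteq> 0 \<and> b \<noteq> r" by (simp add: gf4_eval)
  then obtain b where "b \<noteq> 0" "b \<noteq> inverse m" by blast
  then show False using coversE[OF c] const by metis
qed

text \<open>In a shortest cycle no two consecutive triples have the same centre, by
  \<open>arrow_shortcut\<close>; then the sets where the first step takes the central value shrink forever.\<close>

lemma acyclic_arrow:
  assumes comp: "compatible X Y A B" and finY: "finite Y"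
  shows "acyclic {(x, y). x \<in> X \<and> y \<in> X \<and> arrow Y A B x y}" (is "acyclic ?R")
proof (rule acyclicI, rule allI, rule notI)
  fix x assume "(x, x) \<in> ?R\<^sup>+"
  then obtain n where "n > 0" "(x, x) \<in> ?R ^^ n" using trancl_power by blast
  then have ex: "\<exists>n. n > 0 \<and> (\<exists>x. (x, x) \<in> ?R ^^ n)" by blast
  define n where "n = (LEAST n. n > 0 \<and> (\<exists>x. (x, x) \<in> ?R ^^ n))"
  have n: "n > 0" "\<exists>x. (x, x) \<in> ?R ^^ n" using LeastI_ex[OF ex] unfolding n_def by auto
  have min: "n \<le> k" if "k > 0" "(x, x) \<in> ?R ^^ k" for k x
    unfolding n_def using that by (intro Least_le) blast
  from n(2) obtain u where "(u, u) \<in> ?R ^^ n" ..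
  then have "\<exists>f. f 0 = u \<and> f n = u \<and> (\<forall>i<n. (f i, f (Suc i)) \<in> ?R)" by (rule relpow_fun_conv[THEN iffD1])
  then obtain f where "f 0 = u \<and> f n = u \<and> (\<forall>i<n. (f i, f (Suc i)) \<in> ?R)" ..
  then have f: "f n = f 0" "\<And>i. i < n \<Longrightarrow> (f i, f (Suc i)) \<in> ?R" by blast+
  \<comment> \<open>Periodic extension of the shortest closed walk, so that every position has
    successors.\<close>
  define w where "w i = f (i mod n)" for i
  have w: "(w i, w (Suc i)) \<in> ?R" for i
  proof -
    have "(f (i mod n), f (Suc (i mod n))) \<in> ?R" by (rule f(2)) (use n(1) in simp)
    moreover have "f (Suc (i mod n)) = w (Suc i)"
      using f(1) by (simp add: w_def mod_Suc)
    ultimately show ?thesis by (simp add: w_def)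
  qed
  have wX: "w i \<in> X" for i using w[of i] by simp
  have "\<exists>\<alpha>. affine_step Y A B (w i) (w (Suc i)) \<alpha> \<and> covers Y \<alpha>" for i
    using w[of i] by (simp add: arrow_def)
  then obtain \<alpha> where \<alpha>: "\<And>i. affine_step Y A B (w i) (w (Suc i)) (\<alpha> i)" "\<And>i. covers Y (\<alpha> i)" by metis
  have nz: "\<alpha> i q \<noteq> 0" if "q \<in> Y" for i q
    using affine_step_nonzero[OF comp wX that \<alpha>(1)] .
  have "\<exists>\<rho>. \<rho> \<noteq> 0 \<and> (\<forall>q\<in>Y. \<alpha> i q = \<rho> \<or> \<alpha> (Suc i) q = \<rho>)" for i
    using chain_cross[OF comp wX wX wX \<alpha>(1) \<alpha>(1) \<alpha>(2) \<alpha>(2)] by metis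
  then obtain \<rho> where \<rho>: "\<And>i. \<rho> i \<noteq> 0" "\<And>i q. q \<in> Y \<Longrightarrow> \<alpha> i q = \<rho> i \<or> \<alpha> (Suc i) q = \<rho> i" by metis
  have "n \<noteq> 1"
    using n(2) not_arrow_self[OF comp] by auto
  then have n2: "n \<ge> 2" using n(1) by simp
  \<comment> \<open>With equal centres, two steps could be replaced by one arrow, giving a closed
    walk of length \<open>n - 1\<close>.\<close>
  have diff: "\<rho> i \<noteq> \<rho> (Suc i)" for i
  proof
    assume eq: "\<rho> i = \<rho> (Suc i)"
    have "arrow Y A B (w i) (w (Suc (Suc i)))"
      by (rule arrow_shortcut[OF comp wX wX wX wX \<alpha>(1) \<alpha>(1) \<alpha>(1) \<alpha>(2) \<alpha>(2) \<alpha>(2) \<rho>(1)[of i]])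
        (use \<rho>(2)[of _ i] \<rho>(2)[of _ "Suc i"] eq in auto)
    then have "(w i, w (Suc (Suc i))) \<in> ?R" using wX by simp
    moreover have "(w (Suc (Suc i)), w i) \<in> ?R ^^ (n - 2)"
      unfolding relpow_fun_conv
    proof (intro exI conjI allI impI)
      show "w (Suc (Suc i) + 0) = w (Suc (Suc i))" by simp
      have "Suc (Suc i) + (n - 2) = i + n" using n2 by simp
      then show "w (Suc (Suc i) + (n - 2)) = w i" by (simp only: w_def mod_add_self2)
      show "(w (Suc (Suc i) + j), w (Suc (Suc i) + Suc j)) \<in> ?R" for j
        using w[of "Suc (Suc i) + j"] by simp
    qed
    ultimately have "(w i, w i) \<in> ?R ^^ Suc (n - 2)" by (rule relpow_Suc_I2)
    from min[OF _ this] show False using n2 by simp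
  qed
  define V where "V i = {q \<in> Y. \<alpha> i q = \<rho> i}" for i
  have "V (Suc i) \<subset> V i" for i
  proof
    show "V (Suc i) \<subseteq> V i"
    proof
      fix q assume "q \<in> V (Suc i)"
      then show "q \<in> V i" using \<rho>(2)[of q i] diff[of i] by (auto simp: V_def)
    qed
    \<comment> \<open>Where step \<open>Suc i\<close> takes a value different from both centres, it
      leaves \<open>V (Suc i)\<close>, while cross \<open>i\<close> keeps the column in
      \<open>V i\<close>.\<close>
    obtain c where c: "c \<noteq> 0" "\<rho> i \<noteq> c" "\<rho> (Suc i) \<noteq> c"
      using gf4_obtain_third[OF \<rho>(1) \<rho>(1) diff] by metis
    obtain q where "q \<in> Y" "\<alpha> (Suc i) q = c" using coversE[OF \<alpha>(2) c(1)] by blast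
    then have "q \<in> V i" "q \<notin> V (Suc i)" using \<rho>(2)[of q i] c by (auto simp: V_def)
    then show "V (Suc i) \<noteq> V i" by blast
  qed
  then have less: "card (V (Suc i)) < card (V i)" for i
    using finY by (intro psubset_card_mono) (auto simp: V_def)
  have "card (V i) + i \<le> card (V 0)" for i
  proof (induction i)
    case (Suc i)
    then show ?case using less[of i] by simp
  qed simp
  from this[of "Suc (card (V 0))"] show False by simp
qed

section \<open>From a source of the arrows to the common matrix\<close>

lemma arrow_source:
  assumes comp: "compatible X Y A B" and fin: "finite X" "finite Y" and "X \<noteq> {}"
  obtains z where "z \<in> X" "\<And>x. x \<in> X \<Longrightarrow> \<not> arrow Y A B x z"
proof -
  let ?R = "{(x, y). x \<in> X \<and> y \<in> X \<and> arrow Y A B x y}"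
  have "finite ?R" by (rule finite_subset[of _ "X \<times> X"]) (use fin in auto)
  then have "wf ?R" using acyclic_arrow[OF comp fin(2)] by (rule finite_acyclic_wf)
  moreover obtain u where "u \<in> X" using assms(4) by blast
  ultimately obtain z where "z \<in> X" "\<And>y. (y, z) \<in> ?R \<Longrightarrow> y \<notin> X" by (rule wfE_min) blast
  then show thesis using that by blast
qed

text \<open>Two ratio classes are interpolated by a line. With three, the differences are affine in
  the ratio or in its inverse; the second case yields a covering step from \<open>x'\<close> to
  \<open>x\<close>, which the hypothesis excludes.\<close>

lemma affine_step_or_arrow:
  assumes comp: "compatible X Y A B" and X: "x \<in> X" "x' \<in> X" and no: "\<not> arrow Y A B x' x"
  shows "\<exists>\<alpha>. affine_step Y A B x x' \<alpha>"
proof -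
  define R where "R q = A x' q / A x q" for q
  define D where "D q = B x' q - B x q" for q
  have nz: "A x q \<noteq> 0" "A x' q \<noteq> 0" "R q \<noteq> 0" if "q \<in> Y" for q
    using compatible_nonzero[OF comp _ that] X by (auto simp: R_def)
  have eqv: "R q = R q' \<longleftrightarrow> D q = D q'" if "q \<in> Y" "q' \<in> Y" for q q'
  proof (cases "q = q'")
    case False
    have "R q = R q' \<longleftrightarrow> A x q * A x' q' = A x q' * A x' q"
      using nz[OF that(1)] nz[OF that(2)] by (auto simp: R_def field_simps)
    also have "\<dots> \<longleftrightarrow> B x q - B x q' = B x' q - B x' q'"
      using compatible_pair_det[OF comp X that False] .
    also have "\<dots> \<longleftrightarrow> D q = D q'" by (auto simp: D_def algebra_simps)
    finally show ?thesis .
  qed simp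
  have step: "\<exists>\<alpha>. affine_step Y A B x x' \<alpha>" if "\<mu> \<noteq> 0" "\<And>q. q \<in> Y \<Longrightarrow> D q = \<mu> * R q + k" for \<mu> k
  proof -
    have "affine_step Y A B x x' (\<lambda>q. \<mu> * R q)"
      unfolding affine_step_def
    proof (rule exI[of _ "inverse \<mu>"], rule exI[of _ k], intro conjI ballI)
      fix q assume q: "q \<in> Y"
      show "A x' q = \<mu> * R q * inverse \<mu> * A x q" using that(1) nz[OF q] by (simp add: R_def)
      show "B x' q = \<mu> * R q + k + B x q" using that(2)[OF q] by (simp add: D_def diff_eq_eq)
    qed (use that in auto)
    then show ?thesis by blast
  qed
  show ?thesis
  proof (cases "covers Y R")
    case True
    define W V where WV: "W = GF4 False True" "V = GF4 True True"
    have WVnz: "W \<noteq> 0" "V \<noteq> 0" "(1::gf4) \<noteq> 0" "1 \<noteq> W" "W \<noteq> V" "1 \<noteq> V" by (auto simp: WV gf4_eval)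
    obtain q1 where q1: "q1 \<in> Y" "R q1 = 1" using coversE[OF True, of 1] by auto
    obtain q2 where q2: "q2 \<in> Y" "R q2 = W" using coversE[OF True WVnz(1)] by blast
    obtain q3 where q3: "q3 \<in> Y" "R q3 = V" using coversE[OF True WVnz(2)] by blast
    have d: "D q1 \<noteq> D q2" "D q2 \<noteq> D q3" "D q1 \<noteq> D q3"
      using eqv[OF q1(1) q2(1)] eqv[OF q2(1) q3(1)] eqv[OF q1(1) q3(1)] q1 q2 q3 WVnz by auto
    have three: "R q = 1 \<and> D q = D q1 \<or> R q = W \<and> D q = D q2 \<or> R q = V \<and> D q = D q3" if q: "q \<in> Y" for q
      using gf4_three_values[OF WVnz(3,1,2,4,5,6) nz(3)[OF q]] eqv[OF q q1(1)] eqv[OF q q2(1)] eqv[OF q q3(1)]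
        q1 q2 q3 by auto
    have "\<forall>a b c :: gf4. a \<noteq> b \<longrightarrow> b \<noteq> c \<longrightarrow> a \<noteq> c \<longrightarrow>
      (\<exists>\<mu> k. \<mu> \<noteq> 0 \<and> a = \<mu> * 1 + k \<and> b = \<mu> * W + k \<and> c = \<mu> * V + k) \<or>
      (\<exists>\<mu> k. \<mu> \<noteq> 0 \<and> a = \<mu> * inverse 1 + k \<and> b = \<mu> * inverse W + k \<and> c = \<mu> * inverse V + k)"
      unfolding WV by (simp add: gf4_eval)
    then consider \<mu> k where "\<mu> \<noteq> 0" "D q1 = \<mu> * 1 + k" "D q2 = \<mu> * W + k" "D q3 = \<mu> * V + k"
      | \<mu> k where "\<mu> \<noteq> 0" "D q1 = \<mu> * inverse 1 + k" "D q2 = \<mu> * inverse W + k" "D q3 = \<mu> * inverse V + k"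
      using d by blast
    then show ?thesis
    proof cases
      case 1
      then show ?thesis using step[of \<mu> k] three by metis
    next
      case 2
      have D: "D q = \<mu> * inverse (R q) + k" if "q \<in> Y" for q using three[OF that] 2 by metis
      have "affine_step Y A B x' x (\<lambda>q. \<mu> * inverse (R q))"
        unfolding affine_step_def
      proof (rule exI[of _ "inverse \<mu>"], rule exI[of _ k], intro conjI ballI)
        fix q assume q: "q \<in> Y"
        show "A x q = \<mu> * inverse (R q) * inverse \<mu> * A x' q"
          using 2(1) nz[OF q] by (simp add: R_def field_simps)
        have "B x' q + B x q = \<mu> * inverse (R q) + k"
          using D[OF q] by (simp add: D_def minus_gf4_def)
        then have "B x' q + (B x' q + B x q) = \<mu> * inverse (R q) + k + B x' q" by (simp add: add.commute)
        then show "B x q = \<mu> * inverse (R q) + k + B x' q" by (simp flip: add.assoc)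
      qed (use 2 in auto)
      moreover have "covers Y (\<lambda>q. \<mu> * inverse (R q))"
        unfolding covers_def
      proof (intro allI impI)
        fix a :: gf4 assume a: "a \<noteq> 0"
        then have "\<mu> / a \<noteq> 0" using 2(1) by simp
        then obtain q where "q \<in> Y" "R q = \<mu> / a" using coversE[OF True] by blast
        then show "\<exists>q\<in>Y. \<mu> * inverse (R q) = a" using 2(1) a by (intro bexI[of _ q]) simp_all
      qed
      ultimately show ?thesis using no unfolding arrow_def by blast
    qed
  next
    case False
    then obtain v where v: "v \<noteq> 0" "\<And>q. q \<in> Y \<Longrightarrow> R q \<noteq> v" unfolding covers_def by blast
    show ?thesis
    proof (cases "\<exists>q1\<in>Y. \<exists>q2\<in>Y. R q1 \<noteq> R q2")
      case True
      then obtain q1 q2 where q: "q1 \<in> Y" "q2 \<in> Y" "R q1 \<noteq> R q2" by blast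
      have two: "R q = R q1 \<or> R q = R q2" if "q \<in> Y" for q
        using gf4_three_values[OF nz(3)[OF q(1)] nz(3)[OF q(2)] v(1) q(3) v(2)[OF q(2)] v(2)[OF q(1)] nz(3)[OF that]]
          v(2)[OF that] by blast
      \<comment> \<open>The slope through the two points; it is nonzero because different ratios
        have different differences.\<close>
      define \<mu> where "\<mu> = (D q1 - D q2) / (R q1 - R q2)"
      have mu: "\<mu> \<noteq> 0" using eqv[OF q(1,2)] q(3) by (simp add: \<mu>_def)
      have "\<mu> * R q1 - \<mu> * R q2 = D q1 - D q2"
        unfolding right_diff_distrib[symmetric] using q(3) by (simp add: \<mu>_def)
      then have q2: "D q2 = \<mu> * R q2 + (D q1 - \<mu> * R q1)" by (simp add: algebra_simps)
      have "D q = \<mu> * R q + (D q1 - \<mu> * R q1)" if "q \<in> Y" for q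
        using two[OF that] eqv[OF that q(1)] eqv[OF that q(2)] q2 by auto
      then show ?thesis using step[OF mu] by blast
    next
      case False
      \<comment> \<open>With a single ratio class the slope is arbitrary; 1 is taken and
        \<open>k\<close> absorbs the rest.\<close>
      then have "D q = 1 * R q + k" if "q \<in> Y" "k = D q0 - R q0" "q0 \<in> Y" for q q0 k
        using eqv that by (metis add.commute diff_add_cancel mult_1)
      then show ?thesis using step[of 1] by (cases "Y = {}") (metis ex_in_conv zero_neq_one)+
    qed
  qed
qed

lemma compatible_coloring:
  fixes A B :: "'r \<Rightarrow> 'e \<Rightarrow> gf4"
  assumes comp: "compatible X Y A B" and fin: "finite X" "finite Y"
  obtains g r s where "\<And>x y. x \<in> X \<Longrightarrow> y \<in> Y \<Longrightarrow> A x y = g x y * r x * s y"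
    "pc4_free X Y g" "hexagon_free X Y g"
proof (cases "X = {}")
  case True
  then show thesis using that[of A "\<lambda>_. 1" "\<lambda>_. 1"] by (simp add: pc4_free_def hexagon_free_def)
next
  case False
  obtain z where z: "z \<in> X" "\<And>x. x \<in> X \<Longrightarrow> \<not> arrow Y A B x z"
    using arrow_source[OF comp fin False] by blast
  \<comment> \<open>This includes \<open>x = z\<close>, so the base row also receives its row of
    \<open>g\<close>.\<close>
  have "\<exists>\<alpha>. affine_step Y A B z x \<alpha>" if "x \<in> X" for x
    using affine_step_or_arrow[OF comp z(1) that z(2)[OF that]] .
  then obtain g where "\<And>x. x \<in> X \<Longrightarrow> affine_step Y A B z x (g x)" by metis
  then obtain m k where m: "\<And>x. x \<in> X \<Longrightarrow> m x \<noteq> 0"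
    "\<And>x q. x \<in> X \<Longrightarrow> q \<in> Y \<Longrightarrow> A x q = g x q * m x * A z q"
    "\<And>x q. x \<in> X \<Longrightarrow> q \<in> Y \<Longrightarrow> B x q = g x q + k x + B z q"
    unfolding affine_step_def by metis
  \<comment> \<open>Row \<open>z\<close> provides the column scaling of \<open>A\<close> and the
    column translation of \<open>B\<close>; \<open>m\<close> and \<open>k\<close> act on the
    rows.\<close>
  have "compatible X Y g g"
    by (rule compatible_gauge[OF comp m(2,1) compatible_nonzero[OF comp z(1)] m(3)])
  then show thesis using that[of g m "A z"] m(2) compatible_same_pc4_free compatible_same_hexagon_free by blast
qed

theorem theorem1p1:
  fixes M M' :: "'a matroid_data" and X :: "'a set"
  assumes "matroid M" and "matroid M'"
    and "representable_over TYPE(gf4) M" and "representable_over TYPE(gf4) M'"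
    and "circuit_hyperplane M X" and "M' = relax M X"
  shows "path_width_three M'"
proof -
  interpret M': matroid M' by fact
  have X: "X \<in> bases M'" using assms(6) by (simp add: relax_def)
  obtain A B :: "'a \<Rightarrow> 'a \<Rightarrow> gf4" and v where
    comp: "compatible X (ground M' - X) A B"
    and v: "\<And>S. S \<subseteq> ground M' \<Longrightarrow> indep_in M' S \<longleftrightarrow> lin_indep_fam v S"
    and A: "\<And>y i. y \<in> ground M' - X \<Longrightarrow> v y i = (\<Sum>x\<in>X. A x y * v x i)"
    using relaxation_compatible[OF assms] by blast
  have "finite X" "finite (ground M' - X)"
    using M'.finite_ground M'.bases_subset[OF X] finite_subset by auto
  from compatible_coloring[OF comp this] obtain g r s where
    "\<And>x y. x \<in> X \<Longrightarrow> y \<in> ground M' - X \<Longrightarrow> A x y = g x y * r x * s y"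
    "pc4_free X (ground M' - X) g" "hexagon_free X (ground M' - X) g" by blast
  note g = this
  show ?thesis by (rule M'.path_width_three_of_coloring[OF v X A g])
qed

end
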